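(* Let $n\in\mathbb{N}$. There exist real numbers $\lambda_1(n)$ and $\lambda_2(n)$ with \[ 0\le 1+\log_{2^n}\lambda_1(n)\le 1+\log_{2^n}\lambda_2(n)\qquad\text{and}\qquad \lim_{n\to\infty}\left(1+\log_{2^n}\lambda_2(n)\right)=0, \] such that for almost all $\alpha\in(0,1)$ (with respect to Lebesgue measure) and all $\varepsilon>0$ we have \[ N D_N^*(z_k(n))\ll_{n,\alpha,\varepsilon} N^{1+\log_{2^n}\lambda_2(n)+\varepsilon} \] and \[ N D_N^*(z_k(n))\gg N^{1+\log_{2^n}\lambda_1(n)-\varepsilon}. \]
   Context: Perturbed Halton--Kronecker sequence: Fix $n\in\mathbb{N}$ and let $\boldsymbol{c}=(c_0,c_1,\ldots)$ be given by $c_j=1$ if $n\mid j$ and $c_j=0$ otherwise. Let $C$ be the infinite $\{0,1\}$-matrix equal to the identity except that its first row is $\boldsymbol c$. For an integer $k\ge0$ with binary digits $k=k_0+k_12+k_22^2+\cdots$, compute $(y_0,y_1,\ldots)=C(k_0,k_1,\ldots)^{\top}$ modulo $2$ (so $y_0\equiv\sum_j c_jk_j\pmod 2$, $y_i=k_i$ for $i\ge1$) and set $x_k(n)=\sum_{i\ge0}y_i2^{-i-1}$. For real $\alpha$ put $z_k(n)=(x_k(n),\{k\alpha\})$, $\{t\}$ the fractional part. Star discrepancy of the first $N$ terms of a sequence $(s_k)$ in $[0,1)^2$: $D_N^*=\sup_{(x_1,x_2)\in(0,1]^2}\frac1N\left|\#\{0\le k<N:s_k\in[0,x_1)\times[0,x_2)\}-Nx_1x_2\right|$.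 Notation: $A(N)\ll_X B(N)$ means $|A(N)|\le c_X|B(N)|$ for all sufficiently large $N$ with $c_X>0$ depending only on $X$; $A(N)\gg B(N)$ means $|A(N)|\ge c|B(N)|$ for infinitely many $N$, for some constant $c>0$. *)

theory Defs
  imports "HOL-Analysis.Analysis" "HOL-Library.Landau_Symbols"
begin

definition binary_digit :: "nat \<Rightarrow> nat \<Rightarrow> nat" where
  "binary_digit k j = (k div 2 ^ j) mod 2"

definition perturbed_row :: "nat \<Rightarrow> nat \<Rightarrow> nat" where
  "perturbed_row n j = (if n dvd j then 1 else 0)"

definition generating_matrix :: "nat \<Rightarrow> nat \<Rightarrow> nat \<Rightarrow> nat" where
  "generating_matrix n i j =
     (if i = 0 then perturbed_row n j else if i = j then 1 else 0)"

text \<open>The two series below have only finitely many nonzero terms, because \<open>k\<close> has only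
  finitely many nonzero binary digits; the first one is a sum of natural numbers, which is
  then reduced modulo 2.\<close>

definition output_digit :: "nat \<Rightarrow> nat \<Rightarrow> nat \<Rightarrow> nat" where
  "output_digit n k i = (\<Sum>j. generating_matrix n i j * binary_digit k j) mod 2"

definition digital_point :: "nat \<Rightarrow> nat \<Rightarrow> real" where
  "digital_point n k = (\<Sum>i. real (output_digit n k i) / 2 ^ (i + 1))"

definition halton_kronecker :: "nat \<Rightarrow> real \<Rightarrow> nat \<Rightarrow> real \<times> real" where
  "halton_kronecker n \<alpha> k = (digital_point n k, frac (real k * \<alpha>))"

definition star_discrepancy :: "(nat \<Rightarrow> real \<times> real) \<Rightarrow> nat \<Rightarrow> real" where
  "star_discrepancy s N =
     (SUP (x1, x2) \<in> {0<..1} \<times> {0<..1}.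
        1 / real N *
        \<bar>real (card {k. k < N \<and> s k \<in> {0..<x1} \<times> {0..<x2}}) - real N * x1 * x2\<bar>)"

end

theory Submission
  imports Defs "HOL-Number_Theory.Cong" "HOL-Real_Asymp.Real_Asymp"
begin

text \<open>The lower bound is free: with \<open>lam1 n = 1 / 2 ^ n\<close> the exponent is 0, and since the sequence
  starts at the origin, small boxes give \<open>N D_N \<ge> 1/2\<close>.

  For the upper bound take \<open>N \<le> 2 ^ M\<close> and replace \<open>\<alpha>\<close> by \<open>a / Q\<close> with \<open>Q = 2 ^ (3 M)\<close>. Cutting both the first
  coordinate and the range of \<open>k\<close> into dyadic blocks, one has to count those \<open>k\<close> in a residue class
  modulo a power of 2 that have \<open>k a mod Q < v\<close> and a prescribed parity of the digit sum
  \<open>\<Sum> {k_j | n dvd j}\<close>. Fourier analysis on \<open>Z/Q\<close> reduces this to the exponential sums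
  \<open>\<Prod>i<L. 1 + \<sigma> i e(2^i t)\<close> with signs \<open>\<sigma> i\<close>. Their mean modulus over the lattice of mesh \<open>2 ^ -K\<close> is
  submultiplicative in the length: a run of \<open>q\<close> positive signs is a Dirichlet kernel and costs
  \<open>q + 2\<close>, a negative sign costs 2. As only every \<open>n\<close>-th sign is negative, the mean is at most a
  constant times \<open>(2 (n + 1)) ^ (L / n)\<close>, so \<open>lam2 n = 2 (n + 1) / 2 ^ n\<close> works for almost all \<open>\<alpha>\<close> by
  Markov's inequality and the Borel-Cantelli lemma.\<close>

section \<open>Riesz products and their means over dyadic lattices\<close>

text \<open>The obstacle is the leading output digit: it depends on digits of \<open>k\<close> at
  arbitrarily high positions, so a dyadic interval in the first coordinate is not a union of residue
  classes. Writing its parity condition as (1 + sign) / 2 splits every count into a plain one, which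
  yields a Dirichlet kernel, and a signed one, where the sign is multiplicative over the binary
  digits and the exponential sum becomes a Riesz product. Estimated pointwise, a product of L
  factors is only bounded by 2^L, which is no gain. The gain comes from averaging over the numerator
  \<open>a\<close>: a stretch of n factors then costs 2(n + 1) in place of 2^n, and log(2(n + 1)) /
  (n log 2) tends to 0. Since \<open>a\<close> runs through a finite set, these averages are finite
  sums; measure theory enters only at the end, through the intervals of length 1 / Q on which the
  numerator is constant. All other losses (dyadic cuts, Fourier coefficients, exceptional sets) are
  polynomial in M, which is about log N, and disappear in N^\<epsilon>.\<close>

definition unit_char :: "real \<Rightarrow> complex" where
  "unit_char t = cis (2 * pi * t)"

lemma unit_char_add: "unit_char (s + t) = unit_char s * unit_char t"
  by (simp add: unit_char_def cis_mult ring_distribs)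

lemma norm_unit_char [simp]: "norm (unit_char t) = 1"
  by (simp add: unit_char_def)

lemma unit_char_of_nat [simp]: "unit_char (real k) = 1"
  by (simp add: unit_char_def cis_multiple_2pi)

lemma unit_char_zero [simp]: "unit_char 0 = 1"
  by (simp add: unit_char_def)

lemma unit_char_add_nat [simp]: "unit_char (t + real k) = unit_char t"
  by (simp add: unit_char_add)

lemma unit_char_power: "unit_char t ^ j = unit_char (real j * t)"
  by (simp add: unit_char_def Complex.DeMoivre mult_ac)

text \<open>Jordan's inequality: sine is concave on [0, pi/2], so it lies above its chord
  there.\<close>

lemma sin_pi_ge:
  assumes "0 \<le> t" "t \<le> 1 / 2"
  shows "2 * t \<le> sin (pi * t)"
proof -
  have "convex_on {0..pi / 2} (\<lambda>x. - sin x)"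
  proof (rule f''_ge0_imp_convex)
    show "((\<lambda>x. - sin x) has_real_derivative - cos x) (at x)" for x
      by (auto intro!: derivative_eq_intros)
    show "((\<lambda>x. - cos x) has_real_derivative sin x) (at x)" for x
      by (auto intro!: derivative_eq_intros)
    show "0 \<le> sin x" if "x \<in> {0..pi / 2}" for x
      using that by (intro sin_ge_zero) auto
  qed auto
  from convex_onD[OF this, of "2 * t" 0 "pi / 2"] assms show ?thesis
    by (simp add: algebra_simps)
qed

lemma norm_one_minus_unit_char: "norm (1 - unit_char t) = 2 * \<bar>sin (pi * t)\<bar>"
proof -
  have "(norm (1 - unit_char t))\<^sup>2 = (1 - cos (2 * (pi * t)))\<^sup>2 + (sin (2 * (pi * t)))\<^sup>2"
    by (simp add: unit_char_def cmod_power2 mult.assoc)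
  also have "\<dots> = 2 - 2 * cos (2 * (pi * t))"
    using sin_cos_squared_add3[of "2 * (pi * t)"] by (simp add: power2_eq_square algebra_simps)
  also have "\<dots> = (2 * \<bar>sin (pi * t)\<bar>)\<^sup>2"
    by (simp add: cos_double_sin power_mult_distrib)
  finally show ?thesis
    by (metis abs_ge_zero mult_nonneg_nonneg norm_ge_zero power2_eq_iff_nonneg zero_le_numeral)
qed

text \<open>Up to a constant the right side is the reciprocal of the distance from t to the nearest
  integer. Adding the terms for both neighbours 0 and 1 avoids a case split in every later
  sum.\<close>

lemma norm_one_minus_unit_char_inverse_le:
  assumes "0 < t" "t < 1"
  shows "1 / norm (1 - unit_char t) \<le> 1 / (4 * t) + 1 / (4 * (1 - t))"
proof (cases "t \<le> 1 / 2")
  case True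
  have "4 * t \<le> norm (1 - unit_char t)"
    using sin_pi_ge[of t] assms True by (simp add: norm_one_minus_unit_char)
  hence "1 / norm (1 - unit_char t) \<le> 1 / (4 * t)"
    using assms by (intro divide_left_mono mult_pos_pos) auto
  with assms show ?thesis
    by (smt (verit) divide_nonneg_nonneg)
next
  case False
  have "sin (pi * (1 - t)) = sin (pi * t)"
    by (simp add: right_diff_distrib)
  hence "4 * (1 - t) \<le> norm (1 - unit_char t)"
    using sin_pi_ge[of "1 - t"] assms False by (simp add: norm_one_minus_unit_char)
  hence "1 / norm (1 - unit_char t) \<le> 1 / (4 * (1 - t))"
    using assms by (intro divide_left_mono mult_pos_pos) auto
  with assms show ?thesis
    by (smt (verit) divide_nonneg_nonneg)
qed

definition riesz :: "(nat \<Rightarrow> real) \<Rightarrow> nat \<Rightarrow> real \<Rightarrow> complex" where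
  "riesz \<sigma> L t = (\<Prod>i<L. 1 + of_real (\<sigma> i) * unit_char (2 ^ i * t))"

lemma riesz_0 [simp]: "riesz \<sigma> 0 t = 1"
  by (simp add: riesz_def)

text \<open>The factors after the first p form a Riesz product at the dilated point 2^p t. Together
  with periodicity, this self-similarity makes the means submultiplicative.\<close>

lemma riesz_add: "riesz \<sigma> (p + L) t = riesz \<sigma> p t * riesz (\<lambda>i. \<sigma> (p + i)) L (2 ^ p * t)"
proof -
  let ?f = "\<lambda>i. 1 + of_real (\<sigma> i) * unit_char (2 ^ i * t)"
  have "riesz \<sigma> (p + L) t = prod ?f ({..<p} \<union> {p..<p + L})"
    unfolding riesz_def by (rule prod.cong) auto
  also have "\<dots> = prod ?f {..<p} * prod ?f {p..<p + L}"
    by (rule prod.union_disjoint) auto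
  also have "prod ?f {p..<p + L} = (\<Prod>i<L. ?f (p + i))"
    by (rule prod.reindex_bij_witness[of _ "\<lambda>i. p + i" "\<lambda>i. i - p"]) auto
  finally show ?thesis
    by (simp add: riesz_def power_add mult_ac)
qed

lemma riesz_periodic [simp]: "riesz \<sigma> L (t + real k) = riesz \<sigma> L t"
proof -
  have "unit_char (2 ^ i * (t + real k)) = unit_char (2 ^ i * t)" for i
    using unit_char_add_nat[of "2 ^ i * t" "2 ^ i * k"] by (simp add: distrib_left)
  thus ?thesis by (simp add: riesz_def)
qed

lemma norm_riesz_le:
  assumes "\<And>i. \<bar>\<sigma> i\<bar> \<le> 1"
  shows "norm (riesz \<sigma> L t) \<le> 2 ^ L"
proof -
  have "norm (1 + of_real (\<sigma> i) * unit_char (2 ^ i * t)) \<le> 2" for i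
    using norm_triangle_ineq[of 1 "of_real (\<sigma> i) * unit_char (2 ^ i * t)"] assms[of i]
    by (simp add: norm_mult)
  hence "norm (riesz \<sigma> L t) \<le> (\<Prod>i<L. 2)"
    unfolding riesz_def prod_norm[symmetric] by (intro prod_mono) auto
  thus ?thesis by simp
qed

text \<open>Multiplying 1 - z by 1 + z gives 1 - z^2, and the next factor has z^2 in place of z.
  With all signs 1 the product is thus the Dirichlet kernel with 2^q terms.\<close>

lemma riesz_one_telescope: "(1 - unit_char t) * riesz (\<lambda>_. 1) q t = 1 - unit_char (2 ^ q * t)"
proof (induction q)
  case (Suc q)
  have "(1 - unit_char t) * riesz (\<lambda>_. 1) (Suc q) t
      = (1 - unit_char (2 ^ q * t)) * (1 + unit_char (2 ^ q * t))"
    by (simp add: riesz_def flip: Suc.IH)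
  also have "\<dots> = 1 - unit_char (2 ^ q * t) * unit_char (2 ^ q * t)"
    by (simp add: algebra_simps)
  also have "unit_char (2 ^ q * t) * unit_char (2 ^ q * t) = unit_char (2 ^ Suc q * t)"
    by (simp only: power_Suc mult_2 distrib_right unit_char_add)
  finally show ?case .
qed auto

lemma norm_riesz_one_le:
  assumes "0 < t" "t < 1"
  shows "norm (riesz (\<lambda>_. 1) q t) \<le> 1 / (2 * t) + 1 / (2 * (1 - t))"
proof -
  have "sin (pi * t) > 0"
    using assms by (intro sin_gt_zero) auto
  hence pos: "norm (1 - unit_char t) > 0"
    unfolding norm_one_minus_unit_char by simp
  have "norm (1 - unit_char t) * norm (riesz (\<lambda>_. 1) q t) \<le> 2"
    unfolding norm_mult[symmetric] riesz_one_telescope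
    using norm_triangle_ineq4[of 1 "unit_char (2 ^ q * t)"] by simp
  hence "norm (riesz (\<lambda>_. 1) q t) \<le> 2 * (1 / norm (1 - unit_char t))"
    using pos by (simp add: field_simps)
  also have "\<dots> \<le> 2 * (1 / (4 * t) + 1 / (4 * (1 - t)))"
    using norm_one_minus_unit_char_inverse_le[OF assms] by simp
  also have "\<dots> = 1 / (2 * t) + 1 / (2 * (1 - t))"
    using assms by (simp add: divide_simps)
  finally show ?thesis .
qed

text \<open>Each dyadic block [2^K, 2^(K+1)) contributes at most 1.\<close>

lemma sum_inverse_pow2_le: "(\<Sum>h\<in>{1..<2 ^ K}. 1 / real h) \<le> real K"
proof (induction K)
  case (Suc K)
  have "{1..<2 ^ Suc K} = {1..<2 ^ K} \<union> {2 ^ K..<2 ^ Suc K :: nat}"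
    by (auto simp: not_less)
  hence "(\<Sum>h\<in>{1..<2 ^ Suc K}. 1 / real h)
      = (\<Sum>h\<in>{1..<2 ^ K}. 1 / real h) + (\<Sum>h\<in>{2 ^ K..<2 ^ Suc K}. 1 / real h)"
    by (simp add: sum.union_disjoint)
  moreover have "(\<Sum>h\<in>{2 ^ K..<2 ^ Suc K}. 1 / real h) \<le> (\<Sum>h\<in>{2 ^ K..<2 ^ Suc K :: nat}. 1 / 2 ^ K)"
  proof (intro sum_mono divide_left_mono mult_pos_pos)
    fix h :: nat assume "h \<in> {2 ^ K..<2 ^ Suc K}"
    hence "real (2 ^ K) \<le> real h" by (subst of_nat_le_iff) simp
    thus "2 ^ K \<le> real h" by simp
    thus "0 < real h" by (rule less_le_trans[rotated]) simp
  qed auto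
  ultimately show ?case using Suc by simp
qed auto

lemma sum_inverse_symm_le:
  "(\<Sum>h\<in>{1..<2 ^ K}. 1 / (2 * real h) + 1 / (2 * real (2 ^ K - h))) \<le> real K"
proof -
  have "(\<Sum>h\<in>{1..<2 ^ K}. 1 / real (2 ^ K - h)) = (\<Sum>h\<in>{1..<2 ^ K}. 1 / real h)"
    by (rule sum.reindex_bij_witness[of _ "\<lambda>h. 2 ^ K - h" "\<lambda>h. 2 ^ K - h"]) auto
  moreover have "(\<Sum>h\<in>{1..<2 ^ K}. 1 / (2 * real h) + 1 / (2 * real (2 ^ K - h)))
     = (\<Sum>h\<in>{1..<2 ^ K}. 1 / real h) / 2 + (\<Sum>h\<in>{1..<2 ^ K}. 1 / real (2 ^ K - h)) / 2"
    by (simp add: sum.distrib sum_divide_distrib mult.commute)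
  ultimately show ?thesis
    using sum_inverse_pow2_le[of K] by simp
qed

text \<open>The shifted points have spacing 2^-q. The first and the last may be arbitrarily close to
  an integer and get the trivial bound 2^q each; at the others the decay of the Dirichlet kernel
  leaves two halves of a harmonic sum, together at most q. Hence q + 2.\<close>

lemma sum_riesz_one_le:
  assumes "0 \<le> t" "t < 1 / 2 ^ q"
  shows "(\<Sum>r<2 ^ q. norm (riesz (\<lambda>_. 1) q (t + real r / 2 ^ q))) \<le> (real q + 2) * 2 ^ q"
proof -
  define R :: nat where "R = 2 ^ q"
  have R: "R > 0" "real R = 2 ^ q" by (auto simp: R_def)
  define w where "w r = (if r = 0 \<or> r = R - 1 then 0 else 1 / (2 * real r) + 1 / (2 * real (R - 1 - r)))" for r
  have bd: "norm (riesz (\<lambda>_. 1) q (t + real r / R))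
      \<le> (if r = 0 then real R else 0) + (if r = R - 1 then real R else 0) + R * w r" if "r < R" for r
  proof (cases "r = 0 \<or> r = R - 1")
    case True
    have "norm (riesz (\<lambda>_. 1) q (t + real r / R)) \<le> R"
      using norm_riesz_le[of "\<lambda>_. 1" q] by (simp add: R_def)
    moreover have "R * w r = 0" using True by (simp add: w_def)
    ultimately show ?thesis using True by auto
  next
    case False
    define u where "u = t + real r / R"
    have tR: "t < 1 / R" using assms by (simp add: R)
    have lo: "u \<ge> r / R" using assms by (simp add: u_def)
    have hi: "1 - u \<ge> real (R - 1 - r) / R"
    proof -
      have "real (R - 1 - r) / R = 1 - 1 / R - r / R"
        using False that R by (simp add: of_nat_diff field_simps)
      thus ?thesis using tR by (simp add: u_def)
    qed
    have p: "real r / R > 0" "real (R - 1 - r) / R > 0"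
      using False that R(1) by (intro divide_pos_pos; force)+
    have "norm (riesz (\<lambda>_. 1) q u) \<le> 1 / (2 * u) + 1 / (2 * (1 - u))"
      using lo hi p by (intro norm_riesz_one_le) linarith+
    also have "\<dots> \<le> 1 / (2 * (real r / R)) + 1 / (2 * (real (R - 1 - r) / R))"
      using lo hi p by (intro add_mono divide_left_mono mult_pos_pos mult_left_mono) linarith+
    also have "\<dots> = R * w r" using False by (simp add: w_def field_simps)
    finally show ?thesis using False by (simp add: u_def)
  qed
  have half: "(\<Sum>r<R. if r = 0 \<or> r = R - 1 then 0 else 1 / real r) \<le> q"
  proof -
    have "(\<Sum>r<R. if r = 0 \<or> r = R - 1 then 0 else 1 / real r) \<le> (\<Sum>r<R. if r = 0 then 0 else 1 / real r)"
      by (intro sum_mono) auto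
    also have "\<dots> = (\<Sum>r\<in>{1..<R}. 1 / real r)"
      by (intro sum.mono_neutral_cong_right) auto
    finally show ?thesis using sum_inverse_pow2_le[of q] by (simp add: R_def)
  qed
  have "(\<Sum>r<R. if r = 0 \<or> r = R - 1 then 0 else 1 / real (R - 1 - r))
      = (\<Sum>r<R. if r = 0 \<or> r = R - 1 then 0 else 1 / real r)"
    by (rule sum.reindex_bij_witness[of _ "\<lambda>r. R - 1 - r" "\<lambda>r. R - 1 - r"]) auto
  moreover have "(\<Sum>r<R. w r) = (\<Sum>r<R. if r = 0 \<or> r = R - 1 then 0 else 1 / real r) / 2
       + (\<Sum>r<R. if r = 0 \<or> r = R - 1 then 0 else 1 / real (R - 1 - r)) / 2"
    unfolding sum_divide_distrib sum.distrib[symmetric]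
    by (intro sum.cong refl) (simp add: w_def mult.commute del: of_nat_diff)
  ultimately have w: "(\<Sum>r<R. w r) \<le> q" using half by simp
  have "(\<Sum>r<R. norm (riesz (\<lambda>_. 1) q (t + real r / R)))
     \<le> (\<Sum>r<R. (if r = 0 then real R else 0) + (if r = R - 1 then real R else 0) + R * w r)"
    using bd by (intro sum_mono) auto
  also have "\<dots> = 2 * R + R * (\<Sum>r<R. w r)"
    using R by (simp add: sum.distrib sum_distrib_left)
  also have "\<dots> \<le> 2 * real R + real R * real q"
    using w by (simp add: mult_left_mono)
  finally show ?thesis by (simp add: R_def algebra_simps)
qed

text \<open>A discrete substitute for the \<open>L\<^sup>1\<close> norm.\<close>

definition riesz_mean :: "nat \<Rightarrow> (nat \<Rightarrow> real) \<Rightarrow> nat \<Rightarrow> real" where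
  "riesz_mean K \<sigma> L = (\<Sum>a<2 ^ K. norm (riesz \<sigma> L (real a / 2 ^ K))) / 2 ^ K"

lemma sum_lessThan_mult_split:
  fixes f :: "nat \<Rightarrow> 'a::comm_monoid_add"
  shows "(\<Sum>a<A * B. f a) = (\<Sum>b<A. \<Sum>r<B. f (b + A * r))"
proof -
  have "(\<Sum>b<A. \<Sum>r<B. f (b + A * r)) = (\<Sum>(b, r)\<in>{..<A} \<times> {..<B}. f (b + A * r))"
    by (simp add: sum.cartesian_product)
  also have "\<dots> = (\<Sum>a<A * B. f a)"
  proof (rule sum.reindex_bij_witness[of _ "\<lambda>a. (a mod A, a div A)" "\<lambda>(b, r). b + A * r"], goal_cases)
    case (2 x)
    then obtain b r where "x = (b, r)" "b < A" "r < B" by auto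
    moreover have "b + A * r < A * Suc r" using \<open>b < A\<close> by simp
    moreover have "A * Suc r \<le> A * B" using \<open>r < B\<close> by (intro mult_left_mono) auto
    ultimately show ?case by auto
  next
    case (4 a)
    hence "A > 0" by (cases A) auto
    with 4 show ?case by (auto simp: less_mult_imp_div_less mult.commute)
  qed auto
  finally show ?thesis by simp
qed

text \<open>Write a lattice index as b + 2^(K - p) r. Dilation by 2^p turns the part with r into an
  integer, so the last L factors depend on b alone and live on the lattice of mesh 2^-(K - p). The
  sum over r meets only the first p factors, at equally spaced points with offset b / 2^K < 2^-p;
  hence the hypothesis \<open>B\<close> is uniform in the offset.\<close>

lemma riesz_mean_split:
  assumes "p + L \<le> K" and "0 \<le> B"
    and B: "\<And>t. 0 \<le> t \<Longrightarrow> t < 1 / 2 ^ p \<Longrightarrow> (\<Sum>r<2 ^ p. norm (riesz \<sigma> p (t + real r / 2 ^ p))) \<le> B * 2 ^ p"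
  shows "riesz_mean K \<sigma> (p + L) \<le> B * riesz_mean (K - p) (\<lambda>i. \<sigma> (p + i)) L"
proof -
  define K' where "K' = K - p"
  have K: "K = K' + p" using assms by (simp add: K'_def)
  let ?\<sigma>' = "\<lambda>i. \<sigma> (p + i)"
  have eq: "norm (riesz \<sigma> (p + L) (real (b + 2 ^ K' * r) / 2 ^ K)) =
     norm (riesz \<sigma> p (real b / 2 ^ K + real r / 2 ^ p)) * norm (riesz ?\<sigma>' L (real b / 2 ^ K'))" for b r :: nat
  proof -
    have 1: "real (b + 2 ^ K' * r) / 2 ^ K = real b / 2 ^ K + real r / 2 ^ p"
      by (simp add: K power_add field_simps)
    have "2 ^ p * (real b / 2 ^ K + real r / 2 ^ p) = real b / 2 ^ K' + real r"
      by (simp add: K power_add field_simps)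
    with 1 show ?thesis by (simp add: riesz_add norm_mult)
  qed
  have "(\<Sum>a<2 ^ K. norm (riesz \<sigma> (p + L) (real a / 2 ^ K)))
    = (\<Sum>b<2 ^ K'. \<Sum>r<2 ^ p. norm (riesz \<sigma> (p + L) (real (b + 2 ^ K' * r) / 2 ^ K)))"
    by (subst sum_lessThan_mult_split[symmetric]) (simp add: K power_add)
  also have "\<dots> = (\<Sum>b<2 ^ K'. norm (riesz ?\<sigma>' L (real b / 2 ^ K')) *
      (\<Sum>r<2 ^ p. norm (riesz \<sigma> p (real b / 2 ^ K + real r / 2 ^ p))))"
    unfolding eq sum_distrib_left by (intro sum.cong refl mult.commute)
  also have "\<dots> \<le> (\<Sum>b<2 ^ K'. norm (riesz ?\<sigma>' L (real b / 2 ^ K')) * (B * 2 ^ p))"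
  proof (intro sum_mono mult_left_mono B)
    fix b :: nat assume "b \<in> {..<2 ^ K'}"
    hence "real b < real (2 ^ K')" by (subst of_nat_less_iff) simp
    thus "real b / 2 ^ K < 1 / 2 ^ p" by (simp add: K power_add field_simps)
  qed auto
  also have "\<dots> = B * riesz_mean K' ?\<sigma>' L * 2 ^ K"
    by (simp add: riesz_mean_def K power_add sum_distrib_left sum_distrib_right field_simps)
  finally show ?thesis
    by (simp add: riesz_mean_def K'_def field_simps)
qed

lemma riesz_mean_split_trivial:
  assumes "p + L \<le> K" and "\<And>i. \<bar>\<sigma> i\<bar> \<le> 1"
  shows "riesz_mean K \<sigma> (p + L) \<le> 2 ^ p * riesz_mean (K - p) (\<lambda>i. \<sigma> (p + i)) L"
proof (rule riesz_mean_split)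
  show "(\<Sum>r<2 ^ p. norm (riesz \<sigma> p (t + real r / 2 ^ p))) \<le> 2 ^ p * 2 ^ p" for t
    using sum_mono[of "{..<2 ^ p :: nat}" "\<lambda>r. norm (riesz \<sigma> p (t + real r / 2 ^ p))" "\<lambda>_. 2 ^ p"]
      norm_riesz_le[of \<sigma> p] assms by simp
qed (use assms in auto)

lemma riesz_mean_split_one:
  assumes "q + L \<le> K" and "\<And>i. i < q \<Longrightarrow> \<sigma> i = 1"
  shows "riesz_mean K \<sigma> (q + L) \<le> (real q + 2) * riesz_mean (K - q) (\<lambda>i. \<sigma> (q + i)) L"
proof (rule riesz_mean_split)
  have "riesz \<sigma> q t = riesz (\<lambda>_. 1) q t" for t
    using assms by (simp add: riesz_def)
  thus "(\<Sum>r<2 ^ q. norm (riesz \<sigma> q (t + real r / 2 ^ q))) \<le> (real q + 2) * 2 ^ q"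
    if "0 \<le> t" "t < 1 / 2 ^ q" for t
    using sum_riesz_one_le[OF that] by simp
qed (use assms in auto)

lemma riesz_mean_0 [simp]: "riesz_mean K \<sigma> 0 = 1"
  by (simp add: riesz_mean_def)

lemma riesz_mean_le_pow2:
  assumes "\<And>i. \<bar>\<sigma> i\<bar> \<le> 1"
  shows "riesz_mean K \<sigma> L \<le> 2 ^ L"
  using sum_mono[of "{..<2 ^ K :: nat}" "\<lambda>a. norm (riesz \<sigma> L (real a / 2 ^ K))" "\<lambda>_. 2 ^ L"]
    norm_riesz_le[of \<sigma> L] assms by (simp add: riesz_mean_def field_simps)

lemma riesz_mean_one_le:
  assumes "L \<le> K"
  shows "riesz_mean K (\<lambda>_. 1) L \<le> real L + 2"
  using riesz_mean_split_one[of L 0 K "\<lambda>_. 1"] assms by simp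

section \<open>Means for the signs (-1)^c_j of the perturbed row\<close>

definition perturbed_sign :: "nat \<Rightarrow> nat \<Rightarrow> real" where
  "perturbed_sign n j = (if n dvd j then - 1 else 1)"

lemma abs_perturbed_sign [simp]: "\<bar>perturbed_sign n j\<bar> = 1"
  by (simp add: perturbed_sign_def)

lemma exists_next_multiple:
  fixes m n :: nat
  assumes "n \<ge> 1"
  shows "\<exists>p<n. n dvd m + p"
proof (intro exI conjI)
  define p where "p = (n - m mod n) mod n"
  show "p < n" using assms by (simp add: p_def)
  have "(m + p) mod n = (m mod n + (n - m mod n)) mod n"
    unfolding p_def by (simp add: mod_simps)
  also have "\<dots> = 0"
    using assms mod_less_divisor[of n m] by (simp del: mod_less_divisor)
  finally show "n dvd m + p" by auto
qed

text \<open>One period starting at a multiple of n is a minus sign followed by n - 1 plus signs: 2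
  for the former and (n - 1) + 2 for the latter, together 2(n + 1). Fewer than n factors remain at
  the end and are bounded by 2^n.\<close>

lemma riesz_mean_aligned_le:
  assumes "n \<ge> 1" "n dvd m" "L \<le> K"
  shows "riesz_mean K (\<lambda>i. perturbed_sign n (m + i)) L \<le> 2 ^ n * (2 * (real n + 1)) ^ (L div n)"
  using assms
proof (induction L arbitrary: m K rule: less_induct)
  case (less L)
  show ?case
  proof (cases "L < n")
    case True
    have "riesz_mean K (\<lambda>i. perturbed_sign n (m + i)) L \<le> 2 ^ L"
      by (intro riesz_mean_le_pow2) simp
    also have "\<dots> \<le> 2 ^ n" using True by (intro power_increasing) auto
    finally show ?thesis using True by simp
  next
    case False
    define L' where "L' = L - n"
    have L: "L = 1 + ((n - 1) + L')" using False less.prems by (simp add: L'_def)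
    have 1: "riesz_mean K (\<lambda>i. perturbed_sign n (m + i)) L
       \<le> 2 ^ 1 * riesz_mean (K - 1) (\<lambda>i. perturbed_sign n (m + (1 + i))) ((n - 1) + L')"
      unfolding L by (rule riesz_mean_split_trivial) (use less.prems L in auto)
    have 2: "riesz_mean (K - 1) (\<lambda>i. perturbed_sign n (m + (1 + i))) ((n - 1) + L')
       \<le> (real (n - 1) + 2) * riesz_mean (K - 1 - (n - 1)) (\<lambda>i. perturbed_sign n (m + (1 + ((n - 1) + i)))) L'"
    proof (rule riesz_mean_split_one)
      show "perturbed_sign n (m + (1 + i)) = 1" if "i < n - 1" for i
      proof -
        have "\<not> n dvd 1 + i" using that by (auto dest!: dvd_imp_le)
        thus ?thesis using less.prems by (simp add: perturbed_sign_def dvd_add_right_iff del: One_nat_def)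
      qed
    qed (use less.prems L in auto)
    have shift: "m + (1 + ((n - 1) + i)) = (m + n) + i" for i using less.prems by simp
    have 3: "riesz_mean (K - n) (\<lambda>i. perturbed_sign n ((m + n) + i)) L' \<le> 2 ^ n * (2 * (real n + 1)) ^ (L' div n)"
      by (rule less.IH) (use less.prems L in auto)
    have "L div n = Suc (L' div n)"
      using False less.prems by (simp add: L'_def le_div_geq)
    have K1: "K - 1 - (n - 1) = K - n" using less.prems by simp
    have "riesz_mean K (\<lambda>i. perturbed_sign n (m + i)) L
        \<le> 2 * ((real n + 1) * riesz_mean (K - n) (\<lambda>i. perturbed_sign n ((m + n) + i)) L')"
      using 1 2 less.prems unfolding K1 shift by (simp add: of_nat_diff algebra_simps)
    also have "\<dots> \<le> 2 * ((real n + 1) * (2 ^ n * (2 * (real n + 1)) ^ (L' div n)))"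
      using 3 by (intro mult_left_mono) auto
    finally show ?thesis using \<open>L div n = _\<close> by (simp add: algebra_simps)
  qed
qed

text \<open>The fewer than n factors before the first multiple of n are bounded trivially, which
  costs a second 2^n.\<close>

lemma riesz_mean_perturbed_le:
  assumes "n \<ge> 1" "L \<le> K"
  shows "riesz_mean K (\<lambda>i. perturbed_sign n (m + i)) L \<le> 4 ^ n * (2 * (real n + 1)) ^ (L div n)"
proof -
  obtain p where "p < n" and dvd: "n dvd m + p"
    using exists_next_multiple[OF assms(1)] by blast
  have four: "(2::real) ^ n * 2 ^ n = 4 ^ n" by (simp flip: power_mult_distrib)
  have one: "(1::real) \<le> (2 * (real n + 1)) ^ k" for k
    by (intro one_le_power) simp
  show ?thesis
  proof (cases "L \<le> p")
    case True
    have "riesz_mean K (\<lambda>i. perturbed_sign n (m + i)) L \<le> 2 ^ L"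
      by (intro riesz_mean_le_pow2) simp
    also have "\<dots> \<le> 2 ^ n" using True \<open>p < n\<close> by (intro power_increasing) auto
    also have "\<dots> \<le> 4 ^ n" by (intro power_mono) auto
    also have "\<dots> \<le> 4 ^ n * (2 * (real n + 1)) ^ (L div n)"
      using one[of "L div n"] by simp
    finally show ?thesis .
  next
    case False
    define L' where "L' = L - p"
    have L: "L = p + L'" using False by (simp add: L'_def)
    have "riesz_mean K (\<lambda>i. perturbed_sign n (m + i)) L
        \<le> 2 ^ p * riesz_mean (K - p) (\<lambda>i. perturbed_sign n (m + (p + i))) L'"
      unfolding L by (rule riesz_mean_split_trivial) (use assms L in auto)
    also have "\<dots> \<le> 2 ^ p * (2 ^ n * (2 * (real n + 1)) ^ (L' div n))"
      using riesz_mean_aligned_le[OF \<open>n \<ge> 1\<close> dvd, of L' "K - p"] assms L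
      by (intro mult_left_mono) (auto simp: add.assoc)
    also have "\<dots> \<le> 2 ^ n * (2 ^ n * (2 * (real n + 1)) ^ (L div n))"
      using \<open>p < n\<close> by (intro mult_mono power_increasing div_le_mono) (auto simp: L'_def)
    finally show ?thesis by (simp add: four flip: mult.assoc)
  qed
qed

section \<open>Signed counts through finite Fourier analysis\<close>

lemma binary_digit_eq_0: "k < 2 ^ i \<Longrightarrow> binary_digit k i = 0"
  by (simp add: binary_digit_def)

lemma binary_digit_add_low:
  assumes "i < m"
  shows "binary_digit (r + 2 ^ m * j) i = binary_digit r i"
proof -
  obtain d where "m = i + Suc d"
    using assms less_imp_Suc_add[of i m] by auto
  hence "r + 2 ^ m * j = r + (2 ^ d * j * 2) * 2 ^ i"
    by (simp add: power_add mult_ac)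
  hence "(r + 2 ^ m * j) div 2 ^ i = r div 2 ^ i + 2 ^ d * j * 2"
    by (simp only: div_mult_self1 power_not_zero zero_neq_numeral[symmetric] not_False_eq_True)
  thus ?thesis by (simp add: binary_digit_def)
qed

lemma binary_digit_add_high:
  assumes "r < 2 ^ m"
  shows "binary_digit (r + 2 ^ m * j) (m + i) = binary_digit j i"
  using assms by (simp add: binary_digit_def power_add div_mult2_eq)

text \<open>Since k < 2^k, the range \<open>i < k\<close> contains every nonzero digit, so the sign
  is defined without a length parameter; \<open>digit_sign_eq\<close> passes to any sufficient
  length.\<close>

definition digit_sign :: "(nat \<Rightarrow> real) \<Rightarrow> nat \<Rightarrow> real" where
  "digit_sign \<sigma> k = (\<Prod>i<k. \<sigma> i ^ binary_digit k i)"

lemma digit_sign_eq: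
  assumes "k < 2 ^ J"
  shows "digit_sign \<sigma> k = (\<Prod>i<J. \<sigma> i ^ binary_digit k i)"
proof -
  have zero: "binary_digit k i = 0" if "i \<ge> min k J" for i
  proof (cases "i \<ge> J")
    case True
    hence "k < 2 ^ i" by (intro less_le_trans[OF assms power_increasing]) auto
    thus ?thesis by (rule binary_digit_eq_0)
  next
    case False
    hence "k \<le> i" using that by simp
    hence "k < 2 ^ i" using less_exp[of i] by linarith
    thus ?thesis by (rule binary_digit_eq_0)
  qed
  have "(\<Prod>i<k. \<sigma> i ^ binary_digit k i) = (\<Prod>i<min k J. \<sigma> i ^ binary_digit k i)"
    by (rule prod.mono_neutral_right) (auto simp: zero)
  moreover have "(\<Prod>i<J. \<sigma> i ^ binary_digit k i) = (\<Prod>i<min k J. \<sigma> i ^ binary_digit k i)"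
    by (rule prod.mono_neutral_right) (auto simp: zero)
  ultimately show ?thesis by (simp add: digit_sign_def)
qed

lemma digit_sign_0 [simp]: "digit_sign \<sigma> 0 = 1"
  by (simp add: digit_sign_def)

lemma digit_sign_1 [simp]: "digit_sign \<sigma> (Suc 0) = \<sigma> 0"
  by (simp add: digit_sign_def binary_digit_def)

lemma digit_sign_one [simp]: "digit_sign (\<lambda>_. 1) k = 1"
  by (simp add: digit_sign_def)

lemma abs_digit_sign:
  assumes "\<And>i. \<bar>\<sigma> i\<bar> = 1"
  shows "\<bar>digit_sign \<sigma> k\<bar> = 1"
  using assms by (simp add: digit_sign_def abs_prod power_abs)

text \<open>The digits of r and of j occupy disjoint positions. The part above position m sees the
  sign pattern shifted by m, which is the origin of the patterns \<open>m + i\<close> below.\<close>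

lemma digit_sign_add:
  assumes "r < 2 ^ m"
  shows "digit_sign \<sigma> (r + 2 ^ m * j) = digit_sign \<sigma> r * digit_sign (\<lambda>i. \<sigma> (m + i)) j"
proof -
  obtain J where J: "j < 2 ^ J" using less_exp by blast
  have "r + 2 ^ m * j < 2 ^ m * Suc j" using assms by simp
  also have "\<dots> \<le> 2 ^ (m + J)" unfolding power_add using J by (intro mult_left_mono) auto
  finally have "digit_sign \<sigma> (r + 2 ^ m * j) = (\<Prod>i<m + J. \<sigma> i ^ binary_digit (r + 2 ^ m * j) i)"
    by (rule digit_sign_eq)
  also have "{..<m + J} = {..<m} \<union> {m..<m + J}" by auto
  also have "(\<Prod>i\<in>\<dots>. \<sigma> i ^ binary_digit (r + 2 ^ m * j) i)
     = (\<Prod>i<m. \<sigma> i ^ binary_digit (r + 2 ^ m * j) i) * (\<Prod>i\<in>{m..<m + J}. \<sigma> i ^ binary_digit (r + 2 ^ m * j) i)"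
    by (rule prod.union_disjoint) auto
  also have "(\<Prod>i\<in>{m..<m + J}. \<sigma> i ^ binary_digit (r + 2 ^ m * j) i)
     = (\<Prod>i<J. \<sigma> (m + i) ^ binary_digit (r + 2 ^ m * j) (m + i))"
    by (rule prod.reindex_bij_witness[of _ "\<lambda>i. m + i" "\<lambda>i. i - m"]) auto
  also have "\<dots> = digit_sign (\<lambda>i. \<sigma> (m + i)) j"
    using J by (simp add: binary_digit_add_high[OF assms] digit_sign_eq)
  also have "(\<Prod>i<m. \<sigma> i ^ binary_digit (r + 2 ^ m * j) i) = digit_sign \<sigma> r"
    using assms by (simp add: binary_digit_add_low digit_sign_eq)
  finally show ?thesis .
qed

lemma sum_lessThan_double:
  fixes f :: "nat \<Rightarrow> 'a::comm_monoid_add"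
  shows "(\<Sum>j<2 * N. f j) = (\<Sum>j<N. f j) + (\<Sum>j<N. f (j + N))"
  using sum_lessThan_mult_split[where f = f and A = N and B = 2]
  by (simp add: mult.commute numeral_2_eq_2 sum.distrib)

text \<open>When the product is multiplied out, choosing the second summand in factor i corresponds
  to digit i of j being 1; the induction adds the top digit.\<close>

lemma sum_digit_sign_unit_char:
  "(\<Sum>j<2 ^ L. of_real (digit_sign \<sigma> j) * unit_char (real j * t)) = riesz \<sigma> L t"
proof (induction L)
  case 0
  show ?case by (simp add: lessThan_Suc)
next
  case (Suc L)
  have "of_real (digit_sign \<sigma> (j + 2 ^ L)) * unit_char (real (j + 2 ^ L) * t)
      = of_real (digit_sign \<sigma> j) * unit_char (real j * t) * (of_real (\<sigma> L) * unit_char (2 ^ L * t))"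
    if "j < 2 ^ L" for j
    using digit_sign_add[OF that, of \<sigma> 1] by (simp add: unit_char_add distrib_right)
  hence "(\<Sum>j<2 ^ L. of_real (digit_sign \<sigma> (j + 2 ^ L)) * unit_char (real (j + 2 ^ L) * t))
     = riesz \<sigma> L t * (of_real (\<sigma> L) * unit_char (2 ^ L * t))"
    unfolding Suc.IH[symmetric] sum_distrib_right by (intro sum.cong) auto
  hence "(\<Sum>j<2 ^ Suc L. of_real (digit_sign \<sigma> j) * unit_char (real j * t))
      = riesz \<sigma> L t + riesz \<sigma> L t * (of_real (\<sigma> L) * unit_char (2 ^ L * t))"
    by (simp only: power_Suc sum_lessThan_double Suc.IH)
  thus ?case by (simp add: riesz_def algebra_simps)
qed

lemma sum_digit_sign: "of_real (\<Sum>j<2 ^ L. digit_sign \<sigma> j) = riesz \<sigma> L 0"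
  by (simp flip: sum_digit_sign_unit_char)

section \<open>Fourier expansion of an interval of residues\<close>

lemma unit_char_minus_of_nat [simp]: "unit_char (- real k) = 1"
  using unit_char_add[of "- real k" "real k"] by simp

lemma unit_char_eq_1_iff: "unit_char t = 1 \<longleftrightarrow> t \<in> \<int>"
proof -
  have "unit_char t = 1 \<longleftrightarrow> norm (1 - unit_char t) = 0" by auto
  also have "\<dots> \<longleftrightarrow> sin (pi * t) = 0" by (simp add: norm_one_minus_unit_char)
  also have "\<dots> \<longleftrightarrow> t \<in> \<int>" by (auto simp: sin_zero_iff_int2 Ints_def mult.commute)
  finally show ?thesis .
qed

text \<open>The Fourier coefficients on Z/Q of the indicator function of the residues below
  v.\<close>

definition interval_coeff :: "nat \<Rightarrow> nat \<Rightarrow> nat \<Rightarrow> complex" where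
  "interval_coeff Q v h = (\<Sum>u<v. unit_char (- (real h * real u / real Q))) / of_nat Q"

lemma interval_coeff_0: "interval_coeff Q v 0 = of_real (real v / real Q)"
  by (simp add: interval_coeff_def)

text \<open>A geometric series. The bound is independent of v, so that one exceptional set of slopes
  can later serve all boxes at once.\<close>

lemma norm_interval_coeff_le:
  assumes "0 < h" "h < Q"
  shows "norm (interval_coeff Q v h) \<le> 1 / (2 * real h) + 1 / (2 * real (Q - h))"
proof -
  define t where "t = real h / real Q"
  have t: "0 < t" "t < 1" using assms by (auto simp: t_def)
  define z where "z = unit_char (- t)"
  have nz: "norm (1 - z) = norm (1 - unit_char t)"
    by (simp add: z_def norm_one_minus_unit_char)
  have pos: "norm (1 - unit_char t) > 0"
    using t sin_gt_zero[of "pi * t"] by (simp add: norm_one_minus_unit_char)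
  have "(\<Sum>u<v. unit_char (- (real h * real u / real Q))) = (\<Sum>u<v. z ^ u)"
    by (intro sum.cong) (auto simp: z_def t_def unit_char_power field_simps)
  moreover have "(1 - z) * (\<Sum>u<v. z ^ u) = 1 - z ^ v"
    by (rule one_diff_power_eq[symmetric])
  moreover have "norm (1 - z ^ v) \<le> 2"
    using norm_triangle_ineq4[of 1 "z ^ v"] by (simp add: z_def norm_power)
  ultimately have "norm (1 - z) * norm (\<Sum>u<v. unit_char (- (real h * real u / real Q))) \<le> 2"
    by (metis norm_mult)
  hence "norm (\<Sum>u<v. unit_char (- (real h * real u / real Q))) \<le> 2 * (1 / norm (1 - unit_char t))"
    using pos by (simp add: nz field_simps)
  also have "\<dots> \<le> 2 * (1 / (4 * t) + 1 / (4 * (1 - t)))"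
    using norm_one_minus_unit_char_inverse_le[OF t] by simp
  also have "1 - t = real (Q - h) / real Q"
    using assms by (simp add: t_def of_nat_diff field_simps)
  also have "2 * (1 / (4 * t) + 1 / (4 * (real (Q - h) / real Q)))
      = (1 / (2 * real h) + 1 / (2 * real (Q - h))) * real Q"
    by (simp add: t_def algebra_simps del: of_nat_diff)
  finally show ?thesis
    using assms by (simp add: interval_coeff_def norm_divide divide_le_eq)
qed

lemma sum_unit_char_orthogonal:
  assumes "y < Q" "u < Q"
  shows "(\<Sum>h<Q. unit_char (real h * ((real y - real u) / real Q))) = (if u = y then of_nat Q else 0)"
proof (cases "u = y")
  case False
  define s where "s = (real y - real u) / real Q"
  have "\<bar>s\<bar> < 1" "s \<noteq> 0" using assms False by (auto simp: s_def field_simps abs_if)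
  hence "s \<notin> \<int>" by (metis Ints_nonzero_abs_less1)
  hence "unit_char s \<noteq> 1" by (simp add: unit_char_eq_1_iff)
  moreover have "(1 - unit_char s) * (\<Sum>h<Q. unit_char s ^ h) = 1 - unit_char s ^ Q"
    by (rule one_diff_power_eq[symmetric])
  moreover have "unit_char s ^ Q = 1"
    using assms unit_char_add[of "real y" "- real u"] by (simp add: unit_char_power s_def)
  ultimately have "(\<Sum>h<Q. unit_char s ^ h) = 0" by simp
  thus ?thesis using False by (simp add: unit_char_power s_def)
qed auto

lemma interval_fourier:
  assumes "v \<le> Q" "Q > 0"
  shows "of_bool (y mod Q < v) = (\<Sum>h<Q. interval_coeff Q v h * unit_char (real h * real y / real Q))"
proof -
  define z where "z = y mod Q"
  have z: "z < Q" using assms by (simp add: z_def)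
  have y: "unit_char (real h * real y / real Q) = unit_char (real h * real z / real Q)" for h
  proof -
    have "real y = real (Q * (y div Q) + z)" by (simp add: z_def)
    hence "real h * real y / real Q = real h * real z / real Q + real (h * (y div Q))"
      using assms by (simp add: field_simps)
    thus ?thesis by (metis unit_char_add_nat)
  qed
  have "(\<Sum>h<Q. interval_coeff Q v h * unit_char (real h * real y / real Q))
      = (\<Sum>h<Q. \<Sum>u<v. unit_char (real h * ((real z - real u) / real Q)) / of_nat Q)"
    unfolding y interval_coeff_def sum_divide_distrib sum_distrib_right
    by (intro sum.cong refl) (simp add: right_diff_distrib diff_divide_distrib flip: unit_char_add)
  also have "\<dots> = (\<Sum>u<v. (\<Sum>h<Q. unit_char (real h * ((real z - real u) / real Q))) / of_nat Q)"
    by (subst sum.swap) (simp add: sum_divide_distrib)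
  also have "\<dots> = (\<Sum>u<v. if u = z then 1 else 0)"
    using assms z by (intro sum.cong refl) (subst sum_unit_char_orthogonal, auto)
  also have "\<dots> = of_bool (z < v)" by simp
  finally show ?thesis by (simp add: z_def)
qed

definition coeff_bound :: "nat \<Rightarrow> nat \<Rightarrow> real" where
  "coeff_bound Q h = 1 / (2 * real h) + 1 / (2 * real (Q - h))"

lemma coeff_bound_nonneg: "coeff_bound Q h \<ge> 0"
  by (simp add: coeff_bound_def)

text \<open>Frequency 0 contributes exactly the subtracted density v / Q. At frequency h the
  progression u + g j leads to the Riesz product at h g / Q, while u enters only through a factor of
  modulus 1; the bound is therefore uniform in u and v.\<close>

lemma signed_interval_count_le:
  assumes "v \<le> Q" "Q > 0"
  shows "\<bar>\<Sum>j<2 ^ L. digit_sign \<sigma> j * (of_bool ((u + g * j) mod Q < v) - real v / real Q)\<bar>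
    \<le> (\<Sum>h\<in>{1..<Q}. coeff_bound Q h * norm (riesz \<sigma> L (real (h * g) / real Q)))"
proof -
  let ?c = "interval_coeff Q v"
  let ?S = "\<Sum>j<2 ^ L. digit_sign \<sigma> j * (of_bool ((u + g * j) mod Q < v) - real v / real Q)"
  have split: "{..<Q} = insert 0 {1..<Q}" using assms by auto
  have fourier: "of_real (of_bool ((u + g * j) mod Q < v) - real v / real Q)
     = (\<Sum>h\<in>{1..<Q}. ?c h * unit_char (real h * real (u + g * j) / real Q))" for j
  proof -
    have "(of_bool ((u + g * j) mod Q < v) :: complex)
        = ?c 0 + (\<Sum>h\<in>{1..<Q}. ?c h * unit_char (real h * real (u + g * j) / real Q))"
      unfolding interval_fourier[OF assms] split by (subst sum.insert) auto
    moreover have "of_real (of_bool ((u + g * j) mod Q < v) - real v / real Q)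
        = (of_bool ((u + g * j) mod Q < v) :: complex) - ?c 0"
      by (simp add: interval_coeff_0)
    ultimately show ?thesis by (simp only: add_diff_cancel_left')
  qed
  have "of_real ?S = (\<Sum>j<2 ^ L. \<Sum>h\<in>{1..<Q}.
       of_real (digit_sign \<sigma> j) * (?c h * unit_char (real h * real (u + g * j) / real Q)))"
    by (simp only: of_real_sum of_real_mult fourier sum_distrib_left)
  also have "\<dots> = (\<Sum>h\<in>{1..<Q}. \<Sum>j<2 ^ L.
       of_real (digit_sign \<sigma> j) * (?c h * unit_char (real h * real (u + g * j) / real Q)))"
    by (rule sum.swap)
  also have "\<dots> = (\<Sum>h\<in>{1..<Q}. ?c h * unit_char (real h * real u / real Q) * riesz \<sigma> L (real (h * g) / real Q))"
  proof (intro sum.cong refl)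
    fix h
    have "real h * real (u + g * j) / real Q = real h * real u / real Q + real j * (real (h * g) / real Q)" for j
      by (simp add: algebra_simps add_divide_distrib)
    hence eq: "unit_char (real h * real (u + g * j) / real Q)
        = unit_char (real h * real u / real Q) * unit_char (real j * (real (h * g) / real Q))" for j
      by (simp only: unit_char_add)
    show "(\<Sum>j<2 ^ L. of_real (digit_sign \<sigma> j) * (?c h * unit_char (real h * real (u + g * j) / real Q)))
       = ?c h * unit_char (real h * real u / real Q) * riesz \<sigma> L (real (h * g) / real Q)"
      unfolding eq sum_digit_sign_unit_char[symmetric] sum_distrib_left
      by (intro sum.cong refl) (simp only: mult_ac)
  qed
  finally have S: "of_real ?S = (\<Sum>h\<in>{1..<Q}. ?c h * unit_char (real h * real u / real Q) * riesz \<sigma> L (real (h * g) / real Q))" .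
  have "\<bar>?S\<bar> = norm (complex_of_real ?S)"
    by (rule norm_of_real[symmetric])
  also have "\<dots> \<le> (\<Sum>h\<in>{1..<Q}. norm (?c h * unit_char (real h * real u / real Q) * riesz \<sigma> L (real (h * g) / real Q)))"
    unfolding S by (rule norm_sum)
  also have "\<dots> \<le> (\<Sum>h\<in>{1..<Q}. coeff_bound Q h * norm (riesz \<sigma> L (real (h * g) / real Q)))"
    unfolding norm_mult norm_unit_char mult_1_right coeff_bound_def
    by (intro sum_mono mult_right_mono norm_interval_coeff_le) auto
  finally show ?thesis .
qed

section \<open>Averages over the numerator \<open>a\<close>\<close>

lemma riesz_mod_pow2: "riesz \<sigma> L (real (x mod 2 ^ K) / 2 ^ K) = riesz \<sigma> L (real x / 2 ^ K)"
proof -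
  have "real (2 ^ K * d + r) / 2 ^ K = real r / 2 ^ K + real d" for d r
    by (simp add: field_simps)
  from this[of "x div 2 ^ K" "x mod 2 ^ K"]
  have "real x / 2 ^ K = real (x mod 2 ^ K) / 2 ^ K + real (x div 2 ^ K)"
    by (simp only: mult_div_mod_eq)
  thus ?thesis by (metis riesz_periodic)
qed

text \<open>Multiplication by an odd number permutes the residues modulo 2^K.\<close>

lemma sum_odd_multiple_mod_pow2:
  fixes q :: nat
  assumes "odd q"
  shows "(\<Sum>a<2 ^ K. f (q * a mod 2 ^ K)) = (\<Sum>a<2 ^ K. f a)"
proof -
  have "coprime q (2 ^ K)" using assms by (simp add: coprime_commute)
  hence inj: "inj_on (\<lambda>a. q * a mod 2 ^ K) {..<2 ^ K}"
    by (intro inj_onI) (metis cong_def cong_less_modulus_unique_nat cong_mult_lcancel_nat lessThan_iff)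
  moreover have "(\<lambda>a. q * a mod 2 ^ K) ` {..<2 ^ K} = {..<2 ^ K}"
    by (rule endo_inj_surj) (use inj in auto)
  ultimately show ?thesis
    by (intro sum.reindex_bij_betw) (simp add: bij_betw_def)
qed

text \<open>The power 2^u cancels against the denominator, leaving the lattice of mesh 2^-(K - u)
  traversed 2^u times; the odd part q merely permutes it.\<close>

lemma sum_riesz_multiples:
  assumes "odd q" "u \<le> K"
  shows "(\<Sum>a<2 ^ K. norm (riesz \<sigma> L (real (2 ^ u * q * a) / 2 ^ K))) = 2 ^ K * riesz_mean (K - u) \<sigma> L"
proof -
  define K' where "K' = K - u"
  have K: "K = K' + u" using assms by (simp add: K'_def)
  define F where "F x = norm (riesz \<sigma> L (real x / 2 ^ K'))" for x :: nat
  have F: "F (x mod 2 ^ K') = F x" for x by (simp add: F_def riesz_mod_pow2)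
  have "(\<Sum>a<2 ^ K. norm (riesz \<sigma> L (real (2 ^ u * q * a) / 2 ^ K))) = (\<Sum>a<2 ^ K' * 2 ^ u. F (q * a))"
    by (simp add: F_def K power_add field_simps)
  also have "\<dots> = (\<Sum>b<2 ^ K'. \<Sum>r<2 ^ u. F (q * (b + 2 ^ K' * r)))"
    by (rule sum_lessThan_mult_split)
  also have "\<dots> = (\<Sum>b<2 ^ K'. \<Sum>r<2 ^ u :: nat. F (q * b mod 2 ^ K'))"
  proof (intro sum.cong refl)
    fix b r :: nat
    have "F (q * (b + 2 ^ K' * r)) = F ((q * b + 2 ^ K' * (q * r)) mod 2 ^ K')"
      unfolding F by (simp add: algebra_simps)
    thus "F (q * (b + 2 ^ K' * r)) = F (q * b mod 2 ^ K')" by simp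
  qed
  also have "\<dots> = 2 ^ u * (\<Sum>b<2 ^ K'. F b)"
    using sum_odd_multiple_mod_pow2[OF assms(1), of F K'] by (simp add: sum_distrib_left[symmetric])
  finally show ?thesis
    by (simp add: riesz_mean_def F_def K power_add)
qed

text \<open>With denominator \<open>2 ^ (3 * M)\<close>, the frequencies \<open>h\<close> that are divisible by such a high power of 2 that
  the rescaled lattice is too coarse for the product are rare and carry small coefficients, so
  the trivial bound suffices for them.\<close>

lemma weighted_riesz_mean_le:
  assumes "\<And>i. \<bar>\<sigma> i\<bar> \<le> 1" and "m + L \<le> M" and "0 \<le> T"
    and T: "\<And>K. L \<le> K \<Longrightarrow> riesz_mean K \<sigma> L \<le> T"
  shows "(\<Sum>a<2 ^ (3 * M). \<Sum>h\<in>{1..<2 ^ (3 * M)}.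
      coeff_bound (2 ^ (3 * M)) h * norm (riesz \<sigma> L (real (h * (2 ^ m * a)) / real (2 ^ (3 * M)))))
    \<le> 2 ^ (3 * M) * (3 * real M * T + 1)"
proof -
  define K where "K = 3 * M"
  \<comment> \<open>If 2^e is the exact power of 2 in h, the frequency h lives on a lattice of 2^(K
    - m - e) points, and the bound \<open>T\<close> applies as long as L <= K - m - e, that is e <=
    s.\<close>
  define s where "s = K - m - L"
  have s: "K = s + (m + L)" using assms by (simp add: s_def K_def)
  have inner: "(\<Sum>a<2 ^ K. norm (riesz \<sigma> L (real (h * (2 ^ m * a)) / 2 ^ K)))
      \<le> 2 ^ K * (T + (if 2 ^ s dvd h then 2 ^ L else 0))" if h: "h \<in> {1..<2 ^ K}" for h
  proof -
    obtain q where q: "h = 2 ^ multiplicity 2 h * q" "odd q"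
      by (rule multiplicity_decompose'[of h 2]) (use h in auto)
    define e where "e = multiplicity 2 h"
    show ?thesis
    proof (cases "e + m + L \<le> K")
      case True
      have eq: "h * (2 ^ m * a) = 2 ^ (e + m) * q * a" for a
        by (subst q(1)) (simp add: e_def power_add mult_ac)
      have "e + m \<le> K" using True by simp
      hence "(\<Sum>a<2 ^ K. norm (riesz \<sigma> L (real (h * (2 ^ m * a)) / 2 ^ K))) = 2 ^ K * riesz_mean (K - (e + m)) \<sigma> L"
        unfolding eq by (rule sum_riesz_multiples[OF q(2)])
      also have "\<dots> \<le> 2 ^ K * (T + 0)" using True by (intro mult_left_mono) (auto intro: T)
      also have "\<dots> \<le> 2 ^ K * (T + (if 2 ^ s dvd h then 2 ^ L else 0))"
        by (intro mult_left_mono add_left_mono) auto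
      finally show ?thesis .
    next
      case False
      hence "s \<le> e" using s by simp
      hence "(2::nat) ^ s dvd 2 ^ e" by (rule le_imp_power_dvd)
      hence dvd: "2 ^ s dvd h" using q by (metis e_def dvd_mult2)
      have "(\<Sum>a<2 ^ K. norm (riesz \<sigma> L (real (h * (2 ^ m * a)) / 2 ^ K))) \<le> (\<Sum>a<2 ^ K :: nat. 2 ^ L)"
        by (intro sum_mono norm_riesz_le assms)
      also have "\<dots> \<le> 2 ^ K * (T + (if 2 ^ s dvd h then 2 ^ L else 0))"
        using dvd \<open>0 \<le> T\<close> by simp
      finally show ?thesis .
    qed
  qed
  define D where "D = {h \<in> {1..<2 ^ K :: nat}. 2 ^ s dvd h}"
  have "card D \<le> card ((\<lambda>i. 2 ^ s * i) ` {..<2 ^ (m + L) :: nat})"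
    unfolding D_def s power_add by (intro card_mono) (auto elim!: dvdE)
  also have "\<dots> \<le> 2 ^ (m + L)"
    using card_image_le[of "{..<2 ^ (m + L) :: nat}" "\<lambda>i. 2 ^ s * i"] by simp
  finally have D: "card D \<le> 2 ^ (m + L)" .
  \<comment> \<open>Both h and 2^K - h are positive multiples of 2^s.\<close>
  have cD: "coeff_bound (2 ^ K) h \<le> 1 / 2 ^ s" if "h \<in> D" for h
  proof -
    have "2 ^ s dvd h" and h: "0 < h" "h < 2 ^ K" using that by (auto simp: D_def)
    moreover have "(2::nat) ^ s dvd 2 ^ K" by (rule le_imp_power_dvd) (simp add: s)
    ultimately have "2 ^ s \<le> h" "2 ^ s \<le> 2 ^ K - h"
      by (auto intro!: dvd_imp_le dvd_diff_nat)
    hence "real (2 ^ s) \<le> real h" "real (2 ^ s) \<le> real (2 ^ K - h)"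
      by (simp_all only: of_nat_le_iff)
    hence "1 / (2 * real h) \<le> 1 / (2 * 2 ^ s)" "1 / (2 * real (2 ^ K - h)) \<le> 1 / (2 * 2 ^ s)"
      using h by (intro divide_left_mono mult_pos_pos; simp)+
    thus ?thesis by (simp add: coeff_bound_def)
  qed
  have "(\<Sum>h\<in>D. coeff_bound (2 ^ K) h * 2 ^ L) \<le> (\<Sum>h\<in>D. 1 / 2 ^ s * 2 ^ L)"
    by (intro sum_mono mult_right_mono cD) auto
  also have "\<dots> = real (card D) * (2 ^ L / 2 ^ s)" by simp
  also have "\<dots> \<le> real (2 ^ (m + L)) * (2 ^ L / 2 ^ s)"
    using D by (intro mult_right_mono) (auto simp only: of_nat_le_iff, auto)
  also have "\<dots> = 2 ^ (m + L + L) / 2 ^ s" by (simp add: power_add)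
  also have "\<dots> \<le> 1"
  proof -
    \<comment> \<open>The factor 3 in the exponent 3M is used here: as s = 3M - m - L, the claim
      reads 2m + 3L <= 3M.\<close>
    have "m + L + L \<le> s" using assms by (simp add: s_def K_def)
    thus ?thesis by (simp add: power_increasing)
  qed
  finally have exc: "(\<Sum>h\<in>D. coeff_bound (2 ^ K) h * 2 ^ L) \<le> 1" .
  have "(\<Sum>a<2 ^ K. \<Sum>h\<in>{1..<2 ^ K}. coeff_bound (2 ^ K) h * norm (riesz \<sigma> L (real (h * (2 ^ m * a)) / 2 ^ K)))
      = (\<Sum>h\<in>{1..<2 ^ K}. coeff_bound (2 ^ K) h * (\<Sum>a<2 ^ K. norm (riesz \<sigma> L (real (h * (2 ^ m * a)) / 2 ^ K))))"
    by (subst sum.swap) (simp add: sum_distrib_left)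
  also have "\<dots> \<le> (\<Sum>h\<in>{1..<2 ^ K}. coeff_bound (2 ^ K) h * (2 ^ K * (T + (if 2 ^ s dvd h then 2 ^ L else 0))))"
    by (intro sum_mono mult_left_mono inner coeff_bound_nonneg)
  also have "\<dots> = 2 ^ K * ((\<Sum>h\<in>{1..<2 ^ K}. coeff_bound (2 ^ K) h) * T
       + (\<Sum>h\<in>{1..<2 ^ K}. if 2 ^ s dvd h then coeff_bound (2 ^ K) h * 2 ^ L else 0))"
    unfolding distrib_left sum_distrib_left sum_distrib_right sum.distrib[symmetric]
    by (intro sum.cong) auto
  also have "(\<Sum>h\<in>{1..<2 ^ K}. if 2 ^ s dvd h then coeff_bound (2 ^ K) h * 2 ^ L else 0)
      = (\<Sum>h\<in>D. coeff_bound (2 ^ K) h * 2 ^ L)"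
    unfolding D_def by (rule sum.inter_filter[symmetric]) simp
  also have "2 ^ K * ((\<Sum>h\<in>{1..<2 ^ K}. coeff_bound (2 ^ K) h) * T + (\<Sum>h\<in>D. coeff_bound (2 ^ K) h * 2 ^ L))
      \<le> 2 ^ K * (real K * T + 1)"
    using exc sum_inverse_symm_le[of K] \<open>0 \<le> T\<close>
    by (intro mult_left_mono add_mono mult_right_mono) (auto simp: coeff_bound_def)
  finally show ?thesis by (simp add: K_def)
qed

section \<open>Digits of the first coordinate\<close>

lemma output_digit_pos:
  assumes "i > 0"
  shows "output_digit n k i = binary_digit k i"
proof -
  have "(\<Sum>j. generating_matrix n i j * binary_digit k j) = (\<Sum>j\<in>{i}. generating_matrix n i j * binary_digit k j)"
    using assms by (intro suminf_finite) (auto simp: generating_matrix_def)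
  also have "\<dots> = binary_digit k i" using assms by (simp add: generating_matrix_def)
  finally show ?thesis by (simp add: output_digit_def binary_digit_def)
qed

lemma output_digit_zero:
  "output_digit n k 0 = (\<Sum>j<k. perturbed_row n j * binary_digit k j) mod 2"
proof -
  have "binary_digit k j = 0" if "j \<ge> k" for j
    using that less_exp[of j] by (intro binary_digit_eq_0) linarith
  hence "(\<Sum>j. generating_matrix n 0 j * binary_digit k j) = (\<Sum>j<k. generating_matrix n 0 j * binary_digit k j)"
    by (intro suminf_finite) auto
  thus ?thesis by (simp add: output_digit_def generating_matrix_def)
qed

lemma output_digit_less_2: "output_digit n k i < 2"
  by (simp add: output_digit_def)

text \<open>Turned into a sign, the parity becomes multiplicative over the binary digits, as the
  Fourier argument requires.\<close>

lemma power_output_digit_zero: "(- 1) ^ output_digit n k 0 = digit_sign (perturbed_sign n) k"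
proof -
  have "(- 1 :: real) ^ (x mod 2) = (- 1) ^ x" for x :: nat
    by (cases "even x") (auto simp: odd_iff_mod_2_eq_one)
  hence "(- 1 :: real) ^ output_digit n k 0 = (- 1) ^ (\<Sum>j<k. perturbed_row n j * binary_digit k j)"
    by (simp add: output_digit_zero)
  also have "\<dots> = (\<Prod>j<k. (- 1) ^ (perturbed_row n j * binary_digit k j))"
    by (simp add: power_sum)
  also have "\<dots> = digit_sign (perturbed_sign n) k"
    unfolding digit_sign_def
    by (intro prod.cong) (auto simp: perturbed_row_def perturbed_sign_def)
  finally show ?thesis .
qed

text \<open>The integer part of 2^m x_k(n): digit 0 is the most significant bit, so an interval of
  prefixes is an interval of the first coordinate.\<close>

primrec output_prefix :: "nat \<Rightarrow> nat \<Rightarrow> nat \<Rightarrow> nat" where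
  "output_prefix n k 0 = 0"
| "output_prefix n k (Suc m) = 2 * output_prefix n k m + output_digit n k m"

lemma output_prefix_div: "output_prefix n k (m + d) div 2 ^ d = output_prefix n k m"
proof (induction d)
  case (Suc d)
  have "output_prefix n k (m + Suc d) div 2 ^ Suc d = (output_prefix n k (m + Suc d) div 2) div 2 ^ d"
    by (simp add: div_mult2_eq)
  also have "output_prefix n k (m + Suc d) div 2 = output_prefix n k (m + d)"
    using output_digit_less_2[of n k "m + d"] by simp
  finally show ?case by (simp add: Suc.IH)
qed auto

lemma digital_point_eq_prefix:
  assumes "k < J"
  shows "digital_point n k = real (output_prefix n k J) / 2 ^ J"
proof -
  have zero: "output_digit n k i = 0" if "i \<ge> J" for i
  proof -
    have "0 < i" "k < 2 ^ i" using that assms less_exp[of i] by linarith+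
    thus ?thesis by (simp add: output_digit_pos binary_digit_eq_0)
  qed
  have "(\<Sum>i. real (output_digit n k i) / 2 ^ (i + 1)) = (\<Sum>i<J. real (output_digit n k i) / 2 ^ (i + 1))"
    by (intro suminf_finite) (auto simp: zero)
  also have "\<dots> = real (output_prefix n k J) / 2 ^ J"
    by (induction J) (auto simp: field_simps)
  finally show ?thesis by (simp add: digital_point_def)
qed

text \<open>The expansion of the first coordinate terminates, so cutting it after M digits loses
  strictly less than 2^-M.\<close>

lemma digital_point_bounds:
  "real (output_prefix n k M) / 2 ^ M \<le> digital_point n k"
  "digital_point n k < (real (output_prefix n k M) + 1) / 2 ^ M"
proof -
  define P where "P = output_prefix n k (M + Suc k)"
  define p where "p = output_prefix n k M"
  have x: "digital_point n k = real P / 2 ^ (M + Suc k)"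
    unfolding P_def by (rule digital_point_eq_prefix) simp
  have p: "P div 2 ^ Suc k = p"
    unfolding P_def p_def by (rule output_prefix_div)
  have "P \<ge> p * 2 ^ Suc k" unfolding p[symmetric] by (rule div_times_less_eq_dividend)
  hence "real P \<ge> real (p * 2 ^ Suc k)" by (simp only: of_nat_le_iff)
  hence 1: "real P \<ge> real p * 2 ^ Suc k"
    by (simp only: of_nat_mult of_nat_power of_nat_numeral)
  have "P < 2 ^ Suc k + P div 2 ^ Suc k * 2 ^ Suc k"
    by (rule dividend_less_div_times) simp
  hence "P < Suc p * 2 ^ Suc k"
    by (simp only: p mult_Suc)
  hence "real P < real (Suc p * 2 ^ Suc k)"
    by (simp only: of_nat_less_iff)
  hence 2: "real P < (real p + 1) * 2 ^ Suc k"
    by (simp only: of_nat_mult of_nat_Suc of_nat_power of_nat_numeral add.commute)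
  from 1 show "real (output_prefix n k M) / 2 ^ M \<le> digital_point n k"
    unfolding x p_def[symmetric] power_add by (simp add: field_simps)
  from 2 show "digital_point n k < (real (output_prefix n k M) + 1) / 2 ^ M"
    unfolding x p_def[symmetric] power_add by (simp add: field_simps)
qed

text \<open>Output digits 1 to m are the digits 1 to m of k, whereas output digit 0 prescribes a
  parity and leaves the lowest digit of k open. Hence the residue condition falls on
  \<open>k div 2\<close> and not on k.\<close>

lemma output_prefix_eq_iff:
  assumes "b < 2 ^ Suc m"
  shows "\<exists>c r. c < 2 \<and> r < 2 ^ m \<and>
    (\<forall>k. output_prefix n k (Suc m) = b \<longleftrightarrow> output_digit n k 0 = c \<and> (k div 2) mod 2 ^ m = r)"
  using assms
proof (induction m arbitrary: b)
  case 0
  thus ?case by (intro exI[of _ b] exI[of _ 0]) auto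
next
  case (Suc m)
  have "b div 2 < 2 ^ Suc m" using Suc.prems by auto
  from Suc.IH[OF this] obtain c r where cr: "c < 2" "r < 2 ^ m"
    "\<And>k. output_prefix n k (Suc m) = b div 2 \<longleftrightarrow> output_digit n k 0 = c \<and> (k div 2) mod 2 ^ m = r"
    by auto
  have "output_prefix n k (Suc (Suc m)) = b \<longleftrightarrow>
      output_digit n k 0 = c \<and> (k div 2) mod 2 ^ Suc m = r + 2 ^ m * (b mod 2)" for k
  proof -
    define y where "y = output_digit n k (Suc m)"
    have y: "y = (k div 2) div 2 ^ m mod 2"
      by (simp add: y_def output_digit_pos binary_digit_def div_mult2_eq)
    have "y < 2" by (simp add: y)
    have "output_prefix n k (Suc (Suc m)) = b \<longleftrightarrow> 2 * output_prefix n k (Suc m) + y = b"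
      by (simp add: y_def)
    also have "\<dots> \<longleftrightarrow> output_prefix n k (Suc m) = b div 2 \<and> y = b mod 2"
      using \<open>y < 2\<close> by (auto simp del: output_prefix.simps)
    also have "\<dots> \<longleftrightarrow> output_digit n k 0 = c \<and> (k div 2) mod 2 ^ m = r \<and> y = b mod 2"
      by (simp only: cr conj_assoc)
    also have "(k div 2) mod 2 ^ m = r \<and> y = b mod 2 \<longleftrightarrow> (k div 2) mod 2 ^ Suc m = r + 2 ^ m * (b mod 2)"
    proof -
      define z where "z = k div 2 mod 2 ^ m"
      have e: "(k div 2) mod 2 ^ Suc m = 2 ^ m * y + z"
        unfolding y z_def by (simp only: power_Suc2 mod_mult2_eq)
      have z: "z < 2 ^ m" by (simp add: z_def)
      have "z = r \<and> y = b mod 2 \<longleftrightarrow> 2 ^ m * y + z = r + 2 ^ m * (b mod 2)"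
      proof (intro iffI conjI)
        assume eq: "2 ^ m * y + z = r + 2 ^ m * (b mod 2)"
        from arg_cong[OF eq, of "\<lambda>x. x div 2 ^ m"] show "y = b mod 2"
          using z cr(2) by simp
        with eq show "z = r" by simp
      qed auto
      thus ?thesis unfolding e z_def .
    qed
    finally show ?thesis .
  qed
  moreover have "r + 2 ^ m * (b mod 2) < 2 ^ Suc m"
  proof -
    have "2 ^ m * (b mod 2) \<le> 2 ^ m" by (cases "even b") (auto simp: odd_iff_mod_2_eq_one)
    with cr(2) show ?thesis unfolding power_Suc by linarith
  qed
  ultimately show ?case using cr(1) by blast
qed

text \<open>The segment [0, N) splits along the binary digits of N into at most one aligned block of
  each length 2^l with l = 0, ..., M. This serves both for the range of k and for the prefixes of
  the first coordinate.\<close>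

lemma dyadic_prefix_sum_le:
  fixes f :: "nat \<Rightarrow> real"
  assumes block: "\<And>l b. l \<le> M \<Longrightarrow> b < 2 ^ (M - l) \<Longrightarrow> \<bar>\<Sum>k<2 ^ l. f (b * 2 ^ l + k)\<bar> \<le> E"
    and "N \<le> 2 ^ M"
  shows "\<bar>\<Sum>k<N. f k\<bar> \<le> (real M + 1) * E"
proof -
  have E: "E \<ge> 0" using block[of 0 0] by auto
  have "\<bar>\<Sum>k<c * 2 ^ (M - d). f k\<bar> \<le> (real d + 1) * E" if "d \<le> M" "c \<le> 2 ^ d" for c d
    using that
  proof (induction d arbitrary: c)
    case 0
    hence "c = 0 \<or> c = 1" by auto
    thus ?case using block[of M 0] E by auto
  next
    case (Suc d)
    define l where "l = M - Suc d"
    have l: "M - d = Suc l" "M - l = Suc d" "l \<le> M" using Suc.prems by (auto simp: l_def)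
    define c' where "c' = c div 2"
    have IH: "\<bar>\<Sum>k<c' * 2 ^ Suc l. f k\<bar> \<le> (real d + 1) * E"
      using Suc.IH[of c'] Suc.prems by (simp add: c'_def l)
    show ?case
    proof (cases "even c")
      case True
      hence "c * 2 ^ l = c' * 2 ^ Suc l" by (simp add: c'_def)
      thus ?thesis using IH E by (simp add: l_def[symmetric] algebra_simps)
    next
      case False
      hence c: "c = 2 * c' + 1" by (simp add: c'_def)
      have eq: "c * 2 ^ l = c' * 2 ^ Suc l + 2 ^ l" by (simp add: c)
      have "(\<Sum>k<A + B. f k) = (\<Sum>k<A. f k) + (\<Sum>k<B. f (A + k))" for A B
        by (induction B) (auto simp: algebra_simps)
      hence "(\<Sum>k<c * 2 ^ l. f k) = (\<Sum>k<c' * 2 ^ Suc l. f k) + (\<Sum>k<2 ^ l. f ((2 * c') * 2 ^ l + k))"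
        by (simp add: eq mult_ac)
      moreover have "\<bar>\<Sum>k<2 ^ l. f ((2 * c') * 2 ^ l + k)\<bar> \<le> E"
        using Suc.prems by (intro block) (auto simp: l c)
      ultimately show ?thesis using IH by (simp add: l_def[symmetric] algebra_simps)
    qed
  qed
  from this[of M N] assms(2) show ?thesis by simp
qed

text \<open>At t = 0 a factor with sign -1 vanishes, and n consecutive positions always include one.
  So only sums of fewer than 2^n signs can be nonzero.\<close>

lemma abs_sum_perturbed_digit_sign_le:
  assumes "n \<ge> 1"
  shows "\<bar>\<Sum>j<2 ^ L. digit_sign (\<lambda>i. perturbed_sign n (m + i)) j\<bar> \<le> 2 ^ n"
proof -
  let ?\<sigma> = "\<lambda>i. perturbed_sign n (m + i)"
  have eq: "\<bar>\<Sum>j<2 ^ L. digit_sign ?\<sigma> j\<bar> = norm (riesz ?\<sigma> L 0)"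
    by (simp only: norm_of_real flip: sum_digit_sign)
  show ?thesis
  proof (cases "L < n")
    case True
    have "norm (riesz ?\<sigma> L 0) \<le> 2 ^ L" by (rule norm_riesz_le) simp
    also have "\<dots> \<le> 2 ^ n" using True by (intro power_increasing) auto
    finally show ?thesis by (simp add: eq)
  next
    case False
    obtain p where "p < n" "n dvd m + p"
      using exists_next_multiple[OF assms(1)] by blast
    hence "perturbed_sign n (m + p) = - 1" by (simp add: perturbed_sign_def)
    hence "riesz ?\<sigma> L 0 = 0"
      using False \<open>p < n\<close> unfolding riesz_def by (intro prod_zero bexI[of _ p]) auto
    thus ?thesis by (simp add: eq)
  qed
qed

section \<open>Dyadic boxes\<close>

text \<open>The bound of \<open>signed_interval_count_le\<close> for the step 2^m a, by which k a
  advances when k runs through a residue class modulo 2^m.\<close>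

definition riesz_weight :: "nat \<Rightarrow> nat \<Rightarrow> (nat \<Rightarrow> real) \<Rightarrow> nat \<Rightarrow> nat \<Rightarrow> real" where
  "riesz_weight Q a \<sigma> m L =
    (\<Sum>h\<in>{1..<Q}. coeff_bound Q h * norm (riesz \<sigma> L (real (h * (2 ^ m * a)) / real Q)))"

lemma riesz_weight_nonneg: "riesz_weight Q a \<sigma> m L \<ge> 0"
  by (auto simp: riesz_weight_def intro!: sum_nonneg mult_nonneg_nonneg coeff_bound_nonneg)

text \<open>Only the digits of j vary, so the parity condition equals (1 + \<open>\<kappa>\<close>
  D(j)) / 2, where the constant sign \<open>\<kappa>\<close> collects c and the fixed digits of s
  and d. Half the plain error and half the signed error give \<open>Z\<close>. Centring the signed
  part at \<open>\<rho>\<close> leaves \<open>\<rho>\<close> / 2 times a bare sum of signs, at most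
  2^n / 2.\<close>

lemma residue_class_sum_le:
  assumes "n \<ge> 1" "v \<le> Q" "Q > 0" "s < 2 ^ m" "m + L = l" "c < 2"
    and Z1: "riesz_weight Q a (\<lambda>_. 1) m L \<le> Z"
    and Z2: "riesz_weight Q a (\<lambda>i. perturbed_sign n (m + i)) m L \<le> Z"
  shows "\<bar>\<Sum>j<2 ^ L. of_bool (output_digit n (d * 2 ^ l + (s + 2 ^ m * j)) 0 = c \<and>
             (d * 2 ^ l + (s + 2 ^ m * j)) * a mod Q < v) - real v / real Q / 2\<bar> \<le> Z + 2 ^ n / 2"
proof -
  define \<rho> where "\<rho> = real v / real Q"
  have \<rho>: "0 \<le> \<rho>" "\<rho> \<le> 1" using assms by (auto simp: \<rho>_def)
  let ?\<sigma> = "\<lambda>i. perturbed_sign n (m + i)"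
  define I :: "nat \<Rightarrow> real" where "I j = of_bool (((d * 2 ^ l + s) * a + 2 ^ m * a * j) mod Q < v)" for j
  have I: "I j = of_bool ((d * 2 ^ l + (s + 2 ^ m * j)) * a mod Q < v)" for j
    by (simp add: I_def algebra_simps)
  define D where "D j = digit_sign ?\<sigma> j" for j
  define \<kappa> where "\<kappa> = (- 1) ^ c * digit_sign (perturbed_sign n) s * digit_sign (\<lambda>i. perturbed_sign n (l + i)) d"
  have \<kappa>: "\<bar>\<kappa>\<bar> = 1" by (simp add: \<kappa>_def abs_mult abs_digit_sign power_abs)
  have g: "of_bool (output_digit n (d * 2 ^ l + (s + 2 ^ m * j)) 0 = c \<and>
       (d * 2 ^ l + (s + 2 ^ m * j)) * a mod Q < v) - \<rho> / 2
     = (I j - \<rho>) / 2 + \<kappa> / 2 * (D j * (I j - \<rho>)) + \<kappa> * \<rho> / 2 * D j" if "j < 2 ^ L" for j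
  proof -
    define y where "y = output_digit n (d * 2 ^ l + (s + 2 ^ m * j)) 0"
    have y: "y < 2" by (simp add: y_def output_digit_less_2)
    have "s + 2 ^ m * j < 2 ^ m * Suc j" using assms by simp
    also have "\<dots> \<le> 2 ^ m * 2 ^ L" using that by (intro mult_left_mono) auto
    also have "\<dots> = 2 ^ l" using assms by (simp flip: power_add)
    finally have "digit_sign (perturbed_sign n) ((s + 2 ^ m * j) + 2 ^ l * d)
       = digit_sign (perturbed_sign n) s * D j * digit_sign (\<lambda>i. perturbed_sign n (l + i)) d"
      using assms by (simp add: digit_sign_add D_def)
    hence "(- 1) ^ c * (- 1) ^ y = \<kappa> * D j"
      unfolding y_def power_output_digit_zero by (simp add: \<kappa>_def mult_ac add_ac)
    moreover have "(- 1) ^ c * (- 1) ^ y = (if y = c then 1 else - 1 :: real)"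
      using y assms(6) by (auto simp: less_2_cases_iff)
    ultimately have "\<kappa> * D j = (if y = c then 1 else - 1)" by simp
    hence "of_bool (y = c) = (1 + \<kappa> * D j) / 2" by auto
    hence "of_bool (y = c) * I j - \<rho> / 2 = (1 + \<kappa> * D j) / 2 * I j - \<rho> / 2" by simp
    also have "\<dots> = (I j - \<rho>) / 2 + \<kappa> / 2 * (D j * (I j - \<rho>)) + \<kappa> * \<rho> / 2 * D j"
      by (simp add: field_simps)
    finally show ?thesis by (simp add: I y_def of_bool_conj)
  qed
  have A: "\<bar>\<Sum>j<2 ^ L. I j - \<rho>\<bar> \<le> Z"
    using signed_interval_count_le[OF assms(2,3), of "\<lambda>_. 1" "(d * 2 ^ l + s) * a" "2 ^ m * a" L] Z1
    by (simp add: I_def \<rho>_def riesz_weight_def)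
  have B: "\<bar>\<Sum>j<2 ^ L. D j * (I j - \<rho>)\<bar> \<le> Z"
    using signed_interval_count_le[OF assms(2,3), of ?\<sigma> "(d * 2 ^ l + s) * a" "2 ^ m * a" L] Z2
    by (simp add: I_def \<rho>_def riesz_weight_def D_def)
  have C: "\<bar>\<Sum>j<2 ^ L. D j\<bar> \<le> 2 ^ n"
    unfolding D_def by (rule abs_sum_perturbed_digit_sign_le[OF assms(1)])
  have "(\<Sum>j<2 ^ L. of_bool (output_digit n (d * 2 ^ l + (s + 2 ^ m * j)) 0 = c \<and>
             (d * 2 ^ l + (s + 2 ^ m * j)) * a mod Q < v) - \<rho> / 2)
      = (\<Sum>j<2 ^ L. (I j - \<rho>) / 2 + \<kappa> / 2 * (D j * (I j - \<rho>)) + \<kappa> * \<rho> / 2 * D j)"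
    by (intro sum.cong refl g) auto
  also have "\<dots> = (\<Sum>j<2 ^ L. I j - \<rho>) / 2 + \<kappa> / 2 * (\<Sum>j<2 ^ L. D j * (I j - \<rho>)) + \<kappa> * \<rho> / 2 * (\<Sum>j<2 ^ L. D j)"
    by (simp only: sum.distrib sum_distrib_left sum_divide_distrib)
  also have "\<bar>\<dots>\<bar> \<le> \<bar>(\<Sum>j<2 ^ L. I j - \<rho>) / 2\<bar> + \<bar>\<kappa> / 2 * (\<Sum>j<2 ^ L. D j * (I j - \<rho>))\<bar>
       + \<bar>\<kappa> * \<rho> / 2 * (\<Sum>j<2 ^ L. D j)\<bar>"
    by linarith
  also have "\<dots> \<le> Z / 2 + Z / 2 + 2 ^ n / 2"
  proof (intro add_mono)
    show "\<bar>(\<Sum>j<2 ^ L. I j - \<rho>) / 2\<bar> \<le> Z / 2" using A by simp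
    show "\<bar>\<kappa> / 2 * (\<Sum>j<2 ^ L. D j * (I j - \<rho>))\<bar> \<le> Z / 2" using B \<kappa> by (simp add: abs_mult)
    have "\<rho> * \<bar>\<Sum>j<2 ^ L. D j\<bar> \<le> 1 * 2 ^ n" using C \<rho> by (intro mult_mono) auto
    thus "\<bar>\<kappa> * \<rho> / 2 * (\<Sum>j<2 ^ L. D j)\<bar> \<le> 2 ^ n / 2" using \<kappa> \<rho> by (simp add: abs_mult)
  qed
  finally show ?thesis by (simp add: \<rho>_def)
qed

text \<open>Once (B + k) div 2 is known modulo 2^m, only the lowest bit of B + k is open, and the
  block is no longer than one period 2^(m+1).\<close>

lemma card_residue_class_le_2:
  fixes B :: nat
  assumes "l \<le> Suc m"
  shows "card {k. k < 2 ^ l \<and> (B + k) div 2 mod 2 ^ m = r} \<le> 2" (is "card ?S \<le> 2")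
proof -
  have "inj_on (\<lambda>k. (B + k) mod 2) ?S"
  proof (rule inj_onI)
    fix k k' assume k: "k \<in> ?S" "k' \<in> ?S" and eq: "(B + k) mod 2 = (B + k') mod 2"
    have "(2::nat) ^ l \<le> 2 ^ Suc m" using assms by (intro power_increasing) auto
    hence "k < 2 ^ Suc m" "k' < 2 ^ Suc m" using k by auto
    moreover have "(B + k) mod 2 ^ Suc m = (B + k') mod 2 ^ Suc m"
      using k eq unfolding power_Suc mod_mult2_eq by simp
    hence "[k = k'] (mod 2 ^ Suc m)"
      by (simp add: cong_def[symmetric] cong_add_lcancel_nat)
    ultimately show "k = k'" by (metis cong_less_modulus_unique_nat)
  qed
  hence "card ?S = card ((\<lambda>k. (B + k) mod 2) ` ?S)" by (simp add: card_image)
  also have "\<dots> \<le> card {0, 1::nat}" by (rule card_mono) auto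
  finally show ?thesis by simp
qed

text \<open>For l >= m > 0 the prefix condition leaves the two residue classes 2r and 2r + 1 modulo
  2^m, each with the parity condition, for a total of 2Z + 2^n. In a block with l < m at most two k
  qualify while the expected number is at most 1; this is the extra 2. For m = 0 the prefix
  condition is void.\<close>

lemma dyadic_block_le:
  assumes "n \<ge> 1" "v \<le> Q" "Q > 0" "m \<le> M" "l \<le> M" "b < 2 ^ m"
    and Z1: "\<And>m L. m + L \<le> M \<Longrightarrow> riesz_weight Q a (\<lambda>_. 1) m L \<le> Z"
    and Z2: "\<And>m L. m + L \<le> M \<Longrightarrow> riesz_weight Q a (\<lambda>i. perturbed_sign n (m + i)) m L \<le> Z"
  shows "\<bar>\<Sum>k<2 ^ l. of_bool (output_prefix n (d * 2 ^ l + k) m = b \<and> (d * 2 ^ l + k) * a mod Q < v)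
      - real v / real Q / 2 ^ m\<bar> \<le> 2 * Z + 2 ^ n + 2"
proof (cases m)
  case 0
  have Z: "Z \<ge> 0" using Z1[of 0 0] riesz_weight_nonneg[of Q a "\<lambda>_. 1" 0 0] by simp
  have "\<bar>\<Sum>k<2 ^ l. digit_sign (\<lambda>_. 1) k * (of_bool ((d * 2 ^ l * a + a * k) mod Q < v) - real v / real Q)\<bar> \<le> Z"
    using signed_interval_count_le[OF assms(2,3), of "\<lambda>_. 1" "d * 2 ^ l * a" a l] Z1[of 0 l] assms(5)
    by (simp add: riesz_weight_def)
  also have "Z \<le> 2 * Z + 2 ^ n + 2" using Z by simp
  finally show ?thesis using 0 assms(6) by (simp add: algebra_simps)
next
  case (Suc m')
  have Z: "Z \<ge> 0" using Z1[of 0 0] riesz_weight_nonneg[of Q a "\<lambda>_. 1" 0 0] by simp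
  define \<rho> where "\<rho> = real v / real Q"
  have \<rho>: "0 \<le> \<rho>" "\<rho> \<le> 1" using assms by (auto simp: \<rho>_def)
  define I where "I k \<longleftrightarrow> k * a mod Q < v" for k
  define B where "B = d * 2 ^ l"
  obtain c r where cr: "c < 2" "r < 2 ^ m'"
    "\<And>k. output_prefix n k m = b \<longleftrightarrow> output_digit n k 0 = c \<and> k div 2 mod 2 ^ m' = r"
    using output_prefix_eq_iff[of b m' n] assms(6) Suc by auto
  show ?thesis
  proof (cases "l < m")
    case True
    define S :: real where "S = (\<Sum>k<2 ^ l. of_bool (output_prefix n (B + k) m = b \<and> I (B + k)))"
    have "S \<le> (\<Sum>k<2 ^ l. of_bool ((B + k) div 2 mod 2 ^ m' = r))"
      unfolding S_def by (intro sum_mono) (auto simp: cr(3))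
    also have "\<dots> = real (card {k. k < 2 ^ l \<and> (B + k) div 2 mod 2 ^ m' = r})"
      by (simp add: of_bool_def sum.If_cases lessThan_def Collect_conj_eq)
    also have "\<dots> \<le> 2"
      using card_residue_class_le_2[of l m' B r] True Suc by simp
    finally have "S \<le> 2" .
    moreover have "S \<ge> 0" unfolding S_def by (intro sum_nonneg) auto
    moreover have "2 ^ l * (\<rho> / 2 ^ m) \<le> 1"
    proof -
      have "(2::real) ^ l \<le> 2 ^ m" using True by (intro power_increasing) auto
      hence "2 ^ l * \<rho> \<le> 2 ^ m * 1" using \<rho> by (intro mult_mono) auto
      thus ?thesis by (simp add: field_simps)
    qed
    moreover have "2 ^ l * (\<rho> / 2 ^ m) \<ge> 0" using \<rho> by simp
    moreover have "(0::real) < 2 ^ n" by simp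
    ultimately have "\<bar>S - 2 ^ l * (\<rho> / 2 ^ m)\<bar> \<le> 2 * Z + 2 ^ n + 2" using Z by linarith
    thus ?thesis by (simp add: S_def sum_subtractf \<rho>_def I_def B_def)
  next
    case False
    define L where "L = l - m"
    have l: "m + L = l" using False by (simp add: L_def)
    define G :: "nat \<Rightarrow> real" where "G k = of_bool (output_digit n k 0 = c \<and> I k) - \<rho> / 2" for k
    define T where "T s = (\<Sum>j<2 ^ L. G (B + (s + 2 ^ m * j)))" for s
    have T: "\<bar>T s\<bar> \<le> Z + 2 ^ n / 2" if "s < 2 ^ m" for s
      unfolding T_def G_def I_def B_def \<rho>_def
      by (rule residue_class_sum_le[OF assms(1-3) that l cr(1)]) (use l assms in \<open>auto intro!: Z1 Z2\<close>)
    have r2: "2 * r < 2 ^ m" "2 * r + 1 < 2 ^ m" using cr(2) by (simp_all add: Suc)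
    have div: "(B + (s + 2 ^ m * j)) div 2 mod 2 ^ m' = s div 2" if "s < 2 ^ m" for s j
    proof -
      have "B + (s + 2 ^ m * j) = s + (d * 2 ^ L * 2 ^ m' + 2 ^ m' * j) * 2"
        by (simp add: B_def l[symmetric] Suc power_add algebra_simps)
      hence "(B + (s + 2 ^ m * j)) div 2 = s div 2 + (d * 2 ^ L + j) * 2 ^ m'"
        by (simp add: algebra_simps)
      moreover have "s div 2 < 2 ^ m'" using that Suc by auto
      ultimately show ?thesis by simp
    qed
    have "(\<Sum>k<2 ^ l. of_bool (output_prefix n (B + k) m = b \<and> I (B + k)))
        = (\<Sum>s<2 ^ m. \<Sum>j<2 ^ L. of_bool (output_prefix n (B + (s + 2 ^ m * j)) m = b \<and> I (B + (s + 2 ^ m * j))) :: real)"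
      by (subst sum_lessThan_mult_split[symmetric]) (simp add: l flip: power_add)
    also have "\<dots> = (\<Sum>s<2 ^ m. of_bool (s div 2 = r) * (T s + 2 ^ L * (\<rho> / 2)))"
    proof (intro sum.cong refl)
      fix s :: nat assume "s \<in> {..<2 ^ m}"
      hence "of_bool (output_prefix n (B + (s + 2 ^ m * j)) m = b \<and> I (B + (s + 2 ^ m * j)))
          = of_bool (s div 2 = r) * (G (B + (s + 2 ^ m * j)) + \<rho> / 2)" for j
        unfolding cr(3) using div[of s j] by (auto simp: G_def)
      hence "(\<Sum>j<2 ^ L. of_bool (output_prefix n (B + (s + 2 ^ m * j)) m = b \<and> I (B + (s + 2 ^ m * j))))
          = of_bool (s div 2 = r) * (\<Sum>j<2 ^ L. G (B + (s + 2 ^ m * j)) + \<rho> / 2)"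
        by (simp only: sum_distrib_left)
      thus "(\<Sum>j<2 ^ L. of_bool (output_prefix n (B + (s + 2 ^ m * j)) m = b \<and> I (B + (s + 2 ^ m * j))))
          = of_bool (s div 2 = r) * (T s + 2 ^ L * (\<rho> / 2))"
        by (simp add: T_def sum.distrib)
    qed
    also have "\<dots> = (\<Sum>s\<in>{2 * r, 2 * r + 1}. of_bool (s div 2 = r) * (T s + 2 ^ L * (\<rho> / 2)))"
      using r2 by (intro sum.mono_neutral_right) auto
    also have "\<dots> = T (2 * r) + T (2 * r + 1) + 2 ^ L * \<rho>" by simp
    finally have "(\<Sum>k<2 ^ l. of_bool (output_prefix n (B + k) m = b \<and> I (B + k)) - \<rho> / 2 ^ m)
        = T (2 * r) + T (2 * r + 1)"
      by (simp add: sum_subtractf l[symmetric] power_add)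
    moreover have "\<bar>T (2 * r) + T (2 * r + 1)\<bar> \<le> 2 * Z + 2 ^ n + 2"
      using T[OF r2(1)] T[OF r2(2)] by linarith
    ultimately show ?thesis by (simp add: \<rho>_def I_def B_def)
  qed
qed

text \<open>Two nested dyadic decompositions, of the first coordinate and of the range of k, each
  costing a factor M + 1.\<close>

lemma dyadic_box_le:
  assumes "n \<ge> 1" "v \<le> Q" "Q > 0" "c \<le> 2 ^ M" "N \<le> 2 ^ M"
    and Z1: "\<And>m L. m + L \<le> M \<Longrightarrow> riesz_weight Q a (\<lambda>_. 1) m L \<le> Z"
    and Z2: "\<And>m L. m + L \<le> M \<Longrightarrow> riesz_weight Q a (\<lambda>i. perturbed_sign n (m + i)) m L \<le> Z"
  shows "\<bar>(\<Sum>k<N. of_bool (output_prefix n k M < c \<and> k * a mod Q < v)) - real N * (real c / 2 ^ M) * (real v / real Q)\<bar>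
     \<le> (real M + 1)\<^sup>2 * (2 * Z + 2 ^ n + 2)"
proof -
  define \<rho> where "\<rho> = real v / real Q"
  define I where "I k \<longleftrightarrow> k * a mod Q < v" for k
  define f :: "nat \<Rightarrow> real" where "f p = (\<Sum>k<N. of_bool (output_prefix n k M = p \<and> I k) - \<rho> / 2 ^ M)" for p
  have "\<bar>\<Sum>p<c. f p\<bar> \<le> (real M + 1) * ((real M + 1) * (2 * Z + 2 ^ n + 2))"
  proof (rule dyadic_prefix_sum_le[OF _ \<open>c \<le> 2 ^ M\<close>])
    fix l b :: nat assume l: "l \<le> M" "b < 2 ^ (M - l)"
    \<comment> \<open>Summed over a block of 2^l prefixes, the condition on all M digits becomes one
      on the first M - l digits.\<close>
    have pre: "(\<Sum>p<2 ^ l. of_bool (output_prefix n k M = b * 2 ^ l + p \<and> I k)) - \<rho> / 2 ^ (M - l)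
        = of_bool (output_prefix n k (M - l) = b \<and> I k) - \<rho> / 2 ^ (M - l)" for k
    proof -
      have P: "output_prefix n k M div 2 ^ l = output_prefix n k (M - l)"
        using output_prefix_div[of n k "M - l" l] l by simp
      have "(\<Sum>p<2 ^ l. of_bool (output_prefix n k M = b * 2 ^ l + p)) = (of_bool (output_prefix n k M div 2 ^ l = b) :: real)"
      proof (cases "output_prefix n k M div 2 ^ l = b")
        case True
        define q where "q = output_prefix n k M mod 2 ^ l"
        have "output_prefix n k M = b * 2 ^ l + q"
          unfolding True[symmetric] q_def by (rule div_mult_mod_eq[symmetric])
        hence "(\<Sum>p<2 ^ l. of_bool (output_prefix n k M = b * 2 ^ l + p)) = (\<Sum>p<2 ^ l. if p = q then 1 else 0 :: real)"
          by (intro sum.cong) auto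
        thus ?thesis using True by (simp add: q_def)
      next
        case False
        hence "output_prefix n k M \<noteq> b * 2 ^ l + p" if "p < 2 ^ l" for p using that by auto
        thus ?thesis using False by simp
      qed
      thus ?thesis by (cases "I k") (auto simp: P)
    qed
    have "(\<Sum>p<2 ^ l. f (b * 2 ^ l + p)) =
        (\<Sum>k<N. \<Sum>p<2 ^ l. of_bool (output_prefix n k M = b * 2 ^ l + p \<and> I k) - \<rho> / 2 ^ M)"
      unfolding f_def by (rule sum.swap)
    also have "\<dots> = (\<Sum>k<N. (\<Sum>p<2 ^ l. of_bool (output_prefix n k M = b * 2 ^ l + p \<and> I k)) - \<rho> / 2 ^ (M - l))"
    proof -
      have "2 ^ l * \<rho> / 2 ^ M = \<rho> / 2 ^ (M - l)"
        using l by (simp add: power_diff)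
      thus ?thesis by (simp add: sum_subtractf)
    qed
    also have "\<dots> = (\<Sum>k<N. of_bool (output_prefix n k (M - l) = b \<and> I k) - \<rho> / 2 ^ (M - l))"
      by (simp only: pre)
    also have "\<bar>\<dots>\<bar> \<le> (real M + 1) * (2 * Z + 2 ^ n + 2)"
      unfolding I_def \<rho>_def
      by (rule dyadic_prefix_sum_le[OF _ \<open>N \<le> 2 ^ M\<close>], rule dyadic_block_le) (use assms l in auto)
    finally show "\<bar>\<Sum>p<2 ^ l. f (b * 2 ^ l + p)\<bar> \<le> (real M + 1) * (2 * Z + 2 ^ n + 2)" .
  qed
  moreover have "(\<Sum>p<c. f p) = (\<Sum>k<N. of_bool (output_prefix n k M < c \<and> I k)) - real N * (real c / 2 ^ M) * \<rho>"
  proof -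
    have "(\<Sum>p<c. of_bool (output_prefix n k M = p \<and> I k)) = (of_bool (output_prefix n k M < c \<and> I k) :: real)" for k
      by (cases "I k") (auto simp: of_bool_def)
    moreover have "(\<Sum>p<c. f p) = (\<Sum>k<N. \<Sum>p<c. of_bool (output_prefix n k M = p \<and> I k) - \<rho> / 2 ^ M)"
      unfolding f_def by (rule sum.swap)
    ultimately show ?thesis by (simp add: sum_subtractf)
  qed
  ultimately show ?thesis by (simp add: I_def \<rho>_def power2_eq_square mult.assoc)
qed

section \<open>From the lattice to the circle\<close>

text \<open>The slope \<open>\<alpha>\<close> is replaced by the rational \<open>a / Q\<close> below it; for \<open>k < N\<close> this shifts the second
  coordinate by less than \<open>2 ^ M / Q\<close>, which also accounts for points close to 1 that wrap around.\<close>

lemma star_discrepancy_term_le: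
  assumes "N \<ge> 1" "N \<le> 2 ^ M" "0 \<le> \<alpha>" "\<alpha> < 1"
    and Q: "Q = 2 ^ (3 * M)" and a: "a = nat \<lfloor>\<alpha> * real Q\<rfloor>"
    and box: "\<And>c v. c \<le> 2 ^ M \<Longrightarrow> v \<le> Q \<Longrightarrow>
      \<bar>(\<Sum>k<N. of_bool (output_prefix n k M < c \<and> k * a mod Q < v)) - real N * (real c / 2 ^ M) * (real v / real Q)\<bar> \<le> E"
    and x: "0 < x1" "x1 \<le> 1" "0 < x2" "x2 \<le> 1"
  shows "\<bar>real (card {k. k < N \<and> halton_kronecker n \<alpha> k \<in> {0..<x1} \<times> {0..<x2}}) - real N * x1 * x2\<bar> \<le> 3 * E + 3"
proof -
  define cnt :: "nat \<Rightarrow> nat \<Rightarrow> real" where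
    "cnt c v = (\<Sum>k<N. of_bool (output_prefix n k M < c \<and> k * a mod Q < v))" for c v
  define R :: real where "R = (\<Sum>k<N. of_bool (digital_point n k < x1 \<and> frac (real k * \<alpha>) < x2))"
  have Qpos: "Q > 0" by (simp add: Q)
  have E: "E \<ge> 0" using box[of 0 0] by simp
  have dp_nonneg: "digital_point n k \<ge> 0" for k
    using digital_point_bounds(1)[of n k 0] by simp
  have "real (card {k. k < N \<and> halton_kronecker n \<alpha> k \<in> {0..<x1} \<times> {0..<x2}})
      = real (card {k\<in>{..<N}. digital_point n k < x1 \<and> frac (real k * \<alpha>) < x2})"
    by (rule arg_cong[where f = "\<lambda>A. real (card A)"]) (auto simp: halton_kronecker_def dp_nonneg)
  also have "\<dots> = R"
    by (simp add: R_def of_bool_def sum.If_cases Int_def)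
  finally have card: "real (card {k. k < N \<and> halton_kronecker n \<alpha> k \<in> {0..<x1} \<times> {0..<x2}}) = R" .

  \<comment> \<open>The condition k a mod Q + 2^M <= Q rules out wrap-around, because k (\<alpha> -
    a / Q) < 2^M / Q for k < N <= 2^M.\<close>
  have frac: "frac (real k * \<alpha>) = real (k * a mod Q) / real Q + real k * (\<alpha> - real a / real Q)"
    and fracge: "real k * (\<alpha> - real a / real Q) \<ge> 0"
    and fraclt: "real (k * a mod Q) / real Q + real k * (\<alpha> - real a / real Q) < real (k * a mod Q + 2 ^ M) / real Q"
    if "k < N" "k * a mod Q + 2 ^ M \<le> Q" for k
  proof -
    define Y where "Y = k * a mod Q"
    define \<delta> where "\<delta> = \<alpha> - real a / real Q"
    have "real a = \<lfloor>\<alpha> * real Q\<rfloor>" using assms(3) by (simp add: a)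
    hence "real a \<le> \<alpha> * real Q" "\<alpha> * real Q < real a + 1" by linarith+
    hence "real a / real Q \<le> \<alpha>" "\<alpha> < (real a + 1) / real Q"
      using Qpos by (simp_all add: pos_divide_le_eq pos_less_divide_eq)
    hence d: "0 \<le> \<delta>" "\<delta> < 1 / real Q" by (simp_all add: \<delta>_def add_divide_distrib)
    show ge: "real k * (\<alpha> - real a / real Q) \<ge> 0" using d by (simp add: \<delta>_def)
    have kM: "real k < 2 ^ M"
    proof -
      have "real k < real (2 ^ M)" using that(1) assms(2) by (subst of_nat_less_iff) simp
      thus ?thesis by simp
    qed
    have "real k * \<delta> \<le> real k * (1 / real Q)" using d by (intro mult_left_mono) auto
    also have "\<dots> < 2 ^ M * (1 / real Q)" using kM Qpos by (intro mult_strict_right_mono) auto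
    finally have kd: "real k * \<delta> < 2 ^ M / real Q" by simp
    show lt: "real (k * a mod Q) / real Q + real k * (\<alpha> - real a / real Q) < real (k * a mod Q + 2 ^ M) / real Q"
      using kd by (simp add: \<delta>_def add_divide_distrib)
    have le1: "real (k * a mod Q + 2 ^ M) / real Q \<le> 1"
    proof -
      have "real (k * a mod Q + 2 ^ M) \<le> real Q" using that(2) by (simp only: of_nat_le_iff)
      thus ?thesis using Qpos by simp
    qed
    have "real (k * a) = real (Q * (k * a div Q) + Y)" unfolding Y_def by (simp only: mult_div_mod_eq)
    hence "real k * \<alpha> = of_int (int (k * a div Q)) + (real Y / real Q + real k * \<delta>)"
      using Qpos by (simp add: \<delta>_def field_simps)
    hence "frac (real k * \<alpha>) = frac (real Y / real Q + real k * \<delta>)"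
      by (simp only: frac_add_of_int_left)
    also have "\<dots> = real Y / real Q + real k * \<delta>"
      using lt le1 ge by (subst frac_eq) (auto simp: Y_def \<delta>_def)
    finally show "frac (real k * \<alpha>) = real (k * a mod Q) / real Q + real k * (\<alpha> - real a / real Q)"
      by (simp add: Y_def \<delta>_def)
  qed

  have NM: "real N \<le> 2 ^ M" using assms(2) by simp
  \<comment> \<open>Total error in the second coordinate: 1 / Q from rounding to a multiple of 1 / Q
    and 2^M / Q from the shift.\<close>
  define \<eta> where "\<eta> = (1 + 2 ^ M) / real Q"
  have \<eta>: "0 \<le> \<eta>" by (simp add: \<eta>_def)
  have "real Q = 2 ^ M * (2 ^ M * 2 ^ M)"
    by (simp add: Q flip: power_add)
  hence N\<eta>: "2 ^ M * \<eta> \<le> 2"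
  proof -
    define z :: real where "z = 2 ^ M"
    have z: "1 \<le> z" by (simp add: z_def)
    hence "1 \<le> z * z" using mult_mono[of 1 z 1 z] by simp
    hence "z * 1 \<le> z * (z * z)" "(z * z) * 1 \<le> (z * z) * z"
      using z by (intro mult_left_mono; simp)+
    hence "z * (1 + z) \<le> 2 * (z * (z * z))" by (simp add: algebra_simps)
    moreover have "real Q = z * (z * z)" using \<open>real Q = _\<close> by (simp add: z_def)
    ultimately show ?thesis using z by (simp add: \<eta>_def z_def[symmetric] pos_divide_le_eq)
  qed
  have N\<eta>': "real N * \<eta> \<le> 2"
    using mult_right_mono[OF NM \<eta>] N\<eta> by simp
  have NM1: "real N * (1 / 2 ^ M) \<le> 1" using NM by simp
  have w: "2 ^ M \<le> Q" unfolding Q by (intro power_increasing) auto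

  have upper: "R \<le> real N * x1 * x2 + 3 + 3 * E"
  proof -
    define c where "c = nat \<lceil>x1 * 2 ^ M\<rceil>"
    define v where "v = nat \<lceil>x2 * real Q\<rceil>"
    have c: "c \<le> 2 ^ M" "x1 * 2 ^ M \<le> real c" "real c \<le> x1 * 2 ^ M + 1"
    proof -
      have "\<lceil>x1 * 2 ^ M\<rceil> \<le> 2 ^ M" using x by (intro ceiling_le) simp
      thus "c \<le> 2 ^ M" by (simp add: c_def nat_le_iff)
      have "real c = \<lceil>x1 * 2 ^ M\<rceil>" using x by (simp add: c_def)
      thus "x1 * 2 ^ M \<le> real c" "real c \<le> x1 * 2 ^ M + 1" by linarith+
    qed
    have v: "v \<le> Q" "x2 * real Q \<le> real v" "real v \<le> x2 * real Q + 1"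
    proof -
      have "\<lceil>x2 * real Q\<rceil> \<le> int Q" using x by (intro ceiling_le) (simp add: mult_left_le_one_le)
      thus "v \<le> Q" by (simp add: v_def nat_le_iff)
      have "real v = \<lceil>x2 * real Q\<rceil>" using x by (simp add: v_def)
      thus "x2 * real Q \<le> real v" "real v \<le> x2 * real Q + 1" by linarith+
    qed
    \<comment> \<open>All points with residue at least Q - 2^M, which may wrap around, are added as
      a difference of two boxes. Three boxes occur in all, hence 3E.\<close>
    have "R \<le> (\<Sum>k<N. of_bool (output_prefix n k M < c \<and> k * a mod Q < v)
       + of_bool (output_prefix n k M < c \<and> k * a mod Q < Q) - of_bool (output_prefix n k M < c \<and> k * a mod Q < Q - 2 ^ M))"
      unfolding R_def
    proof (intro sum_mono)
      fix k assume "k \<in> {..<N}"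
      hence k: "k < N" by simp
      have P: "output_prefix n k M < c" if "digital_point n k < x1"
      proof -
        have "real (output_prefix n k M) / 2 ^ M < x1"
          using digital_point_bounds(1)[of n k M] that by linarith
        hence "real (output_prefix n k M) < real c" using c(2) by (simp add: field_simps)
        thus ?thesis by simp
      qed
      have Y: "k * a mod Q < v" if "frac (real k * \<alpha>) < x2" "k * a mod Q < Q - 2 ^ M"
      proof -
        have le: "k * a mod Q + 2 ^ M \<le> Q" using that(2) by simp
        have "real (k * a mod Q) / real Q < x2"
          using frac[OF k le] fracge[OF k le] that(1) by linarith
        hence "real (k * a mod Q) < real v" using v(2) Qpos by (simp add: field_simps)
        thus ?thesis by simp
      qed
      have Y': "k * a mod Q < Q" using Qpos by simp
      show "of_bool (digital_point n k < x1 \<and> frac (real k * \<alpha>) < x2)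
        \<le> of_bool (output_prefix n k M < c \<and> k * a mod Q < v)
         + of_bool (output_prefix n k M < c \<and> k * a mod Q < Q)
         - (of_bool (output_prefix n k M < c \<and> k * a mod Q < Q - 2 ^ M) :: real)"
        using P Y Y' by (auto simp: of_bool_def)
    qed
    also have "\<dots> = cnt c v + cnt c Q - cnt c (Q - 2 ^ M)"
      by (simp only: cnt_def sum.distrib sum_subtractf)
    also have "\<dots> \<le> (real N * (real c / 2 ^ M) * (real v / real Q) + E)
        + (real N * (real c / 2 ^ M) * (real Q / real Q) + E)
        - (real N * (real c / 2 ^ M) * (real (Q - 2 ^ M) / real Q) - E)"
      using box[OF c(1) v(1)] box[OF c(1) order.refl] box[OF c(1), of "Q - 2 ^ M"]
      unfolding cnt_def[symmetric] by linarith
    also have "\<dots> = real N * ((real c / 2 ^ M) * (real v / real Q + 2 ^ M / real Q)) + 3 * E"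
      using w Qpos by (simp add: of_nat_diff field_simps)
    also have "(real c / 2 ^ M) * (real v / real Q + 2 ^ M / real Q) \<le> x1 * x2 + 1 / 2 ^ M + \<eta>"
    proof -
      define C where "C = real c / 2 ^ M"
      have C: "0 \<le> C" "C \<le> 1" "C \<le> x1 + 1 / 2 ^ M"
        using c(3) c(1) by (simp_all add: C_def field_simps)
      have "real v / real Q + 2 ^ M / real Q \<le> x2 + \<eta>"
        using divide_right_mono[OF v(3), of "real Q"] Qpos by (simp add: \<eta>_def add_divide_distrib)
      hence "C * (real v / real Q + 2 ^ M / real Q) \<le> C * (x2 + \<eta>)"
        using C by (intro mult_left_mono) auto
      also have "\<dots> = C * x2 + C * \<eta>" by (simp add: distrib_left)
      also have "\<dots> \<le> (x1 + 1 / 2 ^ M) * x2 + 1 * \<eta>"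
        using C x \<eta> by (intro add_mono mult_right_mono) auto
      also have "\<dots> = x1 * x2 + (1 / 2 ^ M) * x2 + \<eta>" by (simp add: algebra_simps)
      also have "(1 / 2 ^ M) * x2 \<le> (1 / 2 ^ M) * 1" using x by (intro mult_left_mono) auto
      finally show ?thesis by (simp add: C_def)
    qed
    hence "real N * ((real c / 2 ^ M) * (real v / real Q + 2 ^ M / real Q)) + 3 * E
        \<le> real N * (x1 * x2 + 1 / 2 ^ M + \<eta>) + 3 * E"
      by (intro add_right_mono mult_left_mono) auto
    also have "\<dots> = real N * x1 * x2 + real N * (1 / 2 ^ M) + real N * \<eta> + 3 * E" by (simp add: algebra_simps)
    also have "\<dots> \<le> real N * x1 * x2 + 1 + 2 + 3 * E" using NM1 N\<eta>' by linarith
    finally show ?thesis by simp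
  qed

  have lower: "R \<ge> real N * x1 * x2 - 3 - E"
  proof -
    define c where "c = nat \<lfloor>x1 * 2 ^ M\<rfloor>"
    define v0 where "v0 = nat \<lfloor>x2 * real Q\<rfloor>"
    \<comment> \<open>Lowering the bound by 2^M keeps every counted point below x2 after the shift
      and away from wrap-around. Truncated subtraction gives the empty box if \<open>v0\<close> is
      smaller than 2^M.\<close>
    define v where "v = v0 - 2 ^ M"
    have c: "real c \<le> x1 * 2 ^ M" "real c \<ge> x1 * 2 ^ M - 1"
    proof -
      have "real c = \<lfloor>x1 * 2 ^ M\<rfloor>" using x by (simp add: c_def)
      thus "real c \<le> x1 * 2 ^ M" "real c \<ge> x1 * 2 ^ M - 1" by linarith+
    qed
    have v0: "real v0 \<le> x2 * real Q" "real v0 \<ge> x2 * real Q - 1"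
    proof -
      have "real v0 = \<lfloor>x2 * real Q\<rfloor>" using x by (simp add: v0_def)
      thus "real v0 \<le> x2 * real Q" "real v0 \<ge> x2 * real Q - 1" by linarith+
    qed
    have c': "c \<le> 2 ^ M"
    proof -
      have "real c \<le> 1 * 2 ^ M" using c(1) x by (intro order.trans[OF c(1)] mult_right_mono) auto
      hence "real c \<le> real (2 ^ M)" by simp
      thus ?thesis by (simp only: of_nat_le_iff)
    qed
    have v0Q: "v0 \<le> Q"
    proof -
      have "real v0 \<le> 1 * real Q" using x by (intro order.trans[OF v0(1)] mult_right_mono) auto
      thus ?thesis by simp
    qed
    hence v: "v \<le> Q" by (simp add: v_def)
    have "cnt c v \<le> R"
      unfolding R_def cnt_def
    proof (intro sum_mono)
      fix k assume "k \<in> {..<N}"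
      hence k: "k < N" by simp
      have P: "digital_point n k < x1" if "output_prefix n k M < c"
      proof -
        have "real (output_prefix n k M) + 1 \<le> real c" using that by simp
        hence "(real (output_prefix n k M) + 1) / 2 ^ M \<le> x1" using c(1) by (simp add: field_simps)
        thus ?thesis using digital_point_bounds(2)[of n k M] by linarith
      qed
      have Y: "frac (real k * \<alpha>) < x2" if "k * a mod Q < v"
      proof -
        have lt: "k * a mod Q + 2 ^ M < v0" using that by (simp add: v_def)
        hence le: "k * a mod Q + 2 ^ M \<le> Q" using v0Q by simp
        have "real (k * a mod Q + 2 ^ M) \<le> real v0" using lt by (subst of_nat_le_iff) simp
        hence "real (k * a mod Q + 2 ^ M) / real Q \<le> x2"
          using v0(1) Qpos by (simp add: field_simps)
        thus ?thesis using frac[OF k le] fraclt[OF k le] by linarith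
      qed
      show "of_bool (output_prefix n k M < c \<and> k * a mod Q < v)
          \<le> (of_bool (digital_point n k < x1 \<and> frac (real k * \<alpha>) < x2) :: real)"
        using P Y by (auto simp: of_bool_def)
    qed
    moreover have "cnt c v \<ge> real N * (real c / 2 ^ M) * (real v / real Q) - E"
      using box[OF c' v] unfolding cnt_def[symmetric] by linarith
    moreover have "real N * (real c / 2 ^ M) * (real v / real Q) \<ge> real N * x1 * x2 - 3"
    proof -
      define C where "C = real c / 2 ^ M"
      have C: "0 \<le> C" "C \<le> 1" "C \<ge> x1 - 1 / 2 ^ M"
        using divide_right_mono[OF c(2), of "2 ^ M"] c' by (simp_all add: C_def diff_divide_distrib)
      have "real v \<ge> real v0 - 2 ^ M"
        unfolding v_def by (cases "2 ^ M \<le> v0") (auto simp: of_nat_diff not_le)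
      hence "x2 * real Q - (1 + 2 ^ M) \<le> real v" using v0(2) by linarith
      from divide_right_mono[OF this, of "real Q"] Qpos
      have "real v / real Q \<ge> x2 - \<eta>" by (simp add: \<eta>_def diff_divide_distrib)
      hence "C * (real v / real Q) \<ge> C * (x2 - \<eta>)"
        using C by (intro mult_left_mono) auto
      moreover have "C * (x2 - \<eta>) = C * x2 - C * \<eta>" by (simp add: right_diff_distrib)
      moreover have "C * \<eta> \<le> 1 * \<eta>" using C \<eta> by (intro mult_right_mono) auto
      moreover have "C * x2 \<ge> (x1 - 1 / 2 ^ M) * x2" using C x by (intro mult_right_mono) auto
      moreover have "(x1 - 1 / 2 ^ M) * x2 = x1 * x2 - (1 / 2 ^ M) * x2" by (simp add: left_diff_distrib)
      moreover have "(1 / 2 ^ M) * x2 \<le> (1 / 2 ^ M) * 1" using x by (intro mult_left_mono) auto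
      ultimately have "C * (real v / real Q) \<ge> x1 * x2 - 1 / 2 ^ M - \<eta>" by linarith
      hence "real N * (C * (real v / real Q)) \<ge> real N * (x1 * x2 - 1 / 2 ^ M - \<eta>)"
        by (intro mult_left_mono) auto
      moreover have "real N * (x1 * x2 - 1 / 2 ^ M - \<eta>) = real N * x1 * x2 - real N * (1 / 2 ^ M) - real N * \<eta>"
        by (simp add: algebra_simps)
      ultimately have "real N * (C * (real v / real Q)) \<ge> real N * x1 * x2 - 3"
        using NM1 N\<eta>' by linarith
      thus ?thesis by (simp add: C_def mult.assoc)
    qed
    ultimately show ?thesis by linarith
  qed
  show ?thesis unfolding card using upper lower E by linarith
qed

section \<open>The metric bound\<close>

text \<open>A real supremum has its usual properties only on a family bounded above; here every term
  is at most 1.\<close>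

lemma star_discrepancy_bdd:
  assumes "N \<ge> 1"
  shows "bdd_above ((\<lambda>(x1, x2). 1 / real N *
     \<bar>real (card {k. k < N \<and> s k \<in> {0..<x1} \<times> {0..<x2}}) - real N * x1 * x2\<bar>) ` ({0<..1} \<times> {0<..1::real}))"
proof (rule bdd_aboveI2, clarify)
  fix x1 x2 :: real assume x: "x1 \<in> {0<..1}" "x2 \<in> {0<..1}"
  have "card {k. k < N \<and> s k \<in> {0..<x1} \<times> {0..<x2}} \<le> card {..<N}"
    by (rule card_mono) auto
  moreover have "x1 * x2 \<le> 1 * 1" using x by (intro mult_mono) auto
  hence "real N * (x1 * x2) \<le> real N * 1" by (intro mult_left_mono) auto
  moreover have "real N * (x1 * x2) \<ge> 0" using x by auto
  ultimately have "\<bar>real (card {k. k < N \<and> s k \<in> {0..<x1} \<times> {0..<x2}}) - real N * x1 * x2\<bar> \<le> real N"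
    by (simp add: abs_le_iff mult.assoc)
  thus "1 / real N * \<bar>real (card {k. k < N \<and> s k \<in> {0..<x1} \<times> {0..<x2}}) - real N * x1 * x2\<bar> \<le> 1"
    using assms by simp
qed

lemma star_discrepancy_ge:
  assumes "N \<ge> 1" "0 < x1" "x1 \<le> 1" "0 < x2" "x2 \<le> 1"
  shows "\<bar>real (card {k. k < N \<and> s k \<in> {0..<x1} \<times> {0..<x2}}) - real N * x1 * x2\<bar>
    \<le> real N * star_discrepancy s N"
proof -
  have "1 / real N * \<bar>real (card {k. k < N \<and> s k \<in> {0..<x1} \<times> {0..<x2}}) - real N * x1 * x2\<bar>
     \<le> star_discrepancy s N"
    unfolding star_discrepancy_def
    by (rule cSUP_upper2[OF star_discrepancy_bdd[OF assms(1)], where x = "(x1, x2)"]) (use assms in auto)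
  from mult_left_mono[OF this, of "real N"] assms(1) show ?thesis by simp
qed

lemma star_discrepancy_le:
  assumes "\<And>x1 x2. 0 < x1 \<Longrightarrow> x1 \<le> 1 \<Longrightarrow> 0 < x2 \<Longrightarrow> x2 \<le> 1 \<Longrightarrow>
    \<bar>real (card {k. k < N \<and> s k \<in> {0..<x1} \<times> {0..<x2}}) - real N * x1 * x2\<bar> \<le> B"
    and "N \<ge> 1"
  shows "real N * star_discrepancy s N \<le> B"
proof -
  have "star_discrepancy s N \<le> 1 / real N * B"
    unfolding star_discrepancy_def
  proof (rule cSUP_least, goal_cases)
    case (2 x)
    thus ?case using assms by (cases x) (auto intro!: divide_right_mono)
  qed auto
  from mult_left_mono[OF this, of "real N"] assms(2) show ?thesis by simp
qed

lemma star_discrepancy_halton_kronecker_ge: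
  assumes "N \<ge> 1"
  shows "1 / 2 \<le> real N * star_discrepancy (halton_kronecker n \<alpha>) N"
proof -
  \<comment> \<open>A box of area 1 / (2N) has expected count 1/2 but contains the origin.\<close>
  define x where "x = 1 / (2 * real N)"
  have x: "0 < x" "x \<le> 1" using assms by (auto simp: x_def field_simps)
  define S where "S = {k. k < N \<and> halton_kronecker n \<alpha> k \<in> {0..<x} \<times> {0..<1}}"
  have "digital_point n 0 = 0"
    using digital_point_eq_prefix[of 0 1 n] by (simp add: output_digit_zero)
  hence "0 \<in> S" using x assms by (auto simp: S_def halton_kronecker_def)
  moreover have "finite S" by (simp add: S_def)
  ultimately have "card S > 0" by (auto simp: card_gt_0_iff)
  hence "real (card S) \<ge> 1" by linarith
  moreover have "real N * x * 1 = 1 / 2" using assms by (simp add: x_def)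
  ultimately have "1 / 2 \<le> \<bar>real (card S) - real N * x * 1\<bar>" by linarith
  also have "\<dots> \<le> real N * star_discrepancy (halton_kronecker n \<alpha>) N"
    unfolding S_def by (rule star_discrepancy_ge) (use assms x in auto)
  finally show ?thesis .
qed

text \<open>Summing over all pairs (m, L) lets a single inequality control every weight needed at
  level M, at the price of a factor (M + 1)^2.\<close>

definition riesz_total :: "nat \<Rightarrow> nat \<Rightarrow> nat \<Rightarrow> real" where
  "riesz_total n M a = (\<Sum>m\<le>M. \<Sum>L\<le>M - m.
     riesz_weight (2 ^ (3 * M)) a (\<lambda>_. 1) m L
     + riesz_weight (2 ^ (3 * M)) a (\<lambda>i. perturbed_sign n (m + i)) m L)"

lemma riesz_weight_le_total:
  assumes "m + L \<le> M"
  shows "riesz_weight (2 ^ (3 * M)) a (\<lambda>_. 1) m L \<le> riesz_total n M a"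
    and "riesz_weight (2 ^ (3 * M)) a (\<lambda>i. perturbed_sign n (m + i)) m L \<le> riesz_total n M a"
proof -
  let ?f = "\<lambda>m L. riesz_weight (2 ^ (3 * M)) a (\<lambda>_. 1) m L
     + riesz_weight (2 ^ (3 * M)) a (\<lambda>i. perturbed_sign n (m + i)) m L"
  have nonneg: "?f m L \<ge> 0" for m L by (intro add_nonneg_nonneg riesz_weight_nonneg)
  have "?f m L \<le> (\<Sum>L\<le>M - m. ?f m L)"
    using assms by (intro member_le_sum nonneg) auto
  also have "\<dots> \<le> (\<Sum>m\<le>M. \<Sum>L\<le>M - m. ?f m L)"
    using assms by (intro member_le_sum sum_nonneg nonneg) auto
  finally have le: "?f m L \<le> riesz_total n M a" by (simp add: riesz_total_def)
  have "riesz_weight (2 ^ (3 * M)) a (\<lambda>_. 1) m L \<ge> 0"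
    "riesz_weight (2 ^ (3 * M)) a (\<lambda>i. perturbed_sign n (m + i)) m L \<ge> 0"
    by (rule riesz_weight_nonneg)+
  with le show "riesz_weight (2 ^ (3 * M)) a (\<lambda>_. 1) m L \<le> riesz_total n M a"
    and "riesz_weight (2 ^ (3 * M)) a (\<lambda>i. perturbed_sign n (m + i)) m L \<le> riesz_total n M a"
    by linarith+
qed

lemma riesz_total_nonneg: "riesz_total n M a \<ge> 0"
  unfolding riesz_total_def by (intro sum_nonneg add_nonneg_nonneg riesz_weight_nonneg)

text \<open>A common majorant, for L <= M, of the plain bound L + 2 and the signed bound 4^n (2(n +
  1))^(L div n).\<close>

definition mean_bound :: "nat \<Rightarrow> nat \<Rightarrow> real" where
  "mean_bound n M = 4 ^ n * (real M + 2) * (2 * (real n + 1)) ^ (M div n)"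

lemma riesz_total_mean_le:
  assumes "n \<ge> 1"
  shows "(\<Sum>a<2 ^ (3 * M). riesz_total n M a)
    \<le> 2 ^ (3 * M) * ((real M + 1)\<^sup>2 * (2 * (3 * real M * mean_bound n M + 1)))"
proof -
  let ?Q = "2 ^ (3 * M) :: nat"
  let ?T = "mean_bound n M"
  let ?B = "2 ^ (3 * M) * (3 * real M * ?T + 1) :: real"
  have b1: "(1::real) \<le> (2 * (real n + 1)) ^ k" for k by (intro one_le_power) simp
  have T0: "?T \<ge> 0" by (simp add: mean_bound_def)
  have B0: "?B \<ge> 0" using T0 by simp
  have one: "(\<Sum>a<?Q. riesz_weight ?Q a (\<lambda>_. 1) m L) \<le> ?B" if "m + L \<le> M" for m L
    unfolding riesz_weight_def
  proof (rule weighted_riesz_mean_le[OF _ that T0])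
    fix K assume "L \<le> K"
    hence "riesz_mean K (\<lambda>_. 1) L \<le> real L + 2" by (rule riesz_mean_one_le)
    also have "\<dots> \<le> 1 * (real M + 2) * 1" using that by simp
    also have "\<dots> \<le> ?T"
      unfolding mean_bound_def by (intro mult_mono b1) auto
    finally show "riesz_mean K (\<lambda>_. 1) L \<le> ?T" .
  qed auto
  have two: "(\<Sum>a<?Q. riesz_weight ?Q a (\<lambda>i. perturbed_sign n (m + i)) m L) \<le> ?B" if "m + L \<le> M" for m L
    unfolding riesz_weight_def
  proof (rule weighted_riesz_mean_le[OF _ that T0])
    fix K assume "L \<le> K"
    hence "riesz_mean K (\<lambda>i. perturbed_sign n (m + i)) L \<le> 4 ^ n * (2 * (real n + 1)) ^ (L div n)"
      by (rule riesz_mean_perturbed_le[OF assms])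
    also have "\<dots> \<le> 4 ^ n * (2 * (real n + 1)) ^ (M div n)"
      using that by (intro mult_left_mono power_increasing div_le_mono) auto
    also have "\<dots> \<le> ?T"
      unfolding mean_bound_def by (intro mult_right_mono) auto
    finally show "riesz_mean K (\<lambda>i. perturbed_sign n (m + i)) L \<le> ?T" .
  qed auto
  have "(\<Sum>a<?Q. riesz_total n M a) = (\<Sum>m\<le>M. \<Sum>L\<le>M - m.
     (\<Sum>a<?Q. riesz_weight ?Q a (\<lambda>_. 1) m L) + (\<Sum>a<?Q. riesz_weight ?Q a (\<lambda>i. perturbed_sign n (m + i)) m L))"
  proof -
    have "(\<Sum>a<?Q. riesz_total n M a) = (\<Sum>m\<le>M. \<Sum>a<?Q. \<Sum>L\<le>M - m. riesz_weight ?Q a (\<lambda>_. 1) m L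
        + riesz_weight ?Q a (\<lambda>i. perturbed_sign n (m + i)) m L)"
      unfolding riesz_total_def by (rule sum.swap)
    also have "\<dots> = (\<Sum>m\<le>M. \<Sum>L\<le>M - m. \<Sum>a<?Q. riesz_weight ?Q a (\<lambda>_. 1) m L
        + riesz_weight ?Q a (\<lambda>i. perturbed_sign n (m + i)) m L)"
      by (intro sum.cong refl sum.swap)
    finally show ?thesis by (simp only: sum.distrib)
  qed
  also have "\<dots> \<le> (\<Sum>m\<le>M. \<Sum>L\<le>M - m. 2 * ?B)"
  proof (intro sum_mono)
    fix m L assume "m \<in> {..M}" "L \<in> {..M - m}"
    hence "m + L \<le> M" by auto
    from one[OF this] two[OF this] show "(\<Sum>a<?Q. riesz_weight ?Q a (\<lambda>_. 1) m L)
      + (\<Sum>a<?Q. riesz_weight ?Q a (\<lambda>i. perturbed_sign n (m + i)) m L) \<le> 2 * ?B" by linarith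
  qed
  also have "\<dots> \<le> (\<Sum>m\<le>M. \<Sum>L\<le>M. 2 * ?B)"
    using B0 by (intro sum_mono sum_mono2) auto
  also have "\<dots> = 2 ^ (3 * M) * ((real M + 1)\<^sup>2 * (2 * (3 * real M * ?T + 1)))"
    by (simp add: power2_eq_square algebra_simps)
  finally show ?thesis .
qed

text \<open>The factor \<open>(M + 1)\<^sup>2\<close> on top of the bound for the mean makes the exceptional sets summable.\<close>

definition threshold :: "nat \<Rightarrow> nat \<Rightarrow> real" where
  "threshold n M = (real M + 1)\<^sup>2 * ((real M + 1)\<^sup>2 * (2 * (3 * real M * mean_bound n M + 1)))"

lemma mean_bound_nonneg: "mean_bound n M \<ge> 0"
  by (simp add: mean_bound_def)

text \<open>By Markov's inequality at most 2^(3M) / (M + 1)^2 numerators are bad. Each belongs to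
  the slopes of one interval of length 2^-(3M), so the bad slopes at level M have measure at most 1
  / (M + 1)^2.\<close>

lemma AE_eventually_riesz_total_le:
  assumes "n \<ge> 1"
  shows "AE \<alpha> in lborel. 0 \<le> \<alpha> \<and> \<alpha> < 1 \<longrightarrow>
    eventually (\<lambda>M. riesz_total n M (nat \<lfloor>\<alpha> * real (2 ^ (3 * M))\<rfloor>) \<le> threshold n M) sequentially"
proof -
  define bad where "bad M = {a. a < 2 ^ (3 * M) \<and> threshold n M < riesz_total n M a}" for M
  define A where "A M = (\<Union>a\<in>bad M. {real a / 2 ^ (3 * M)..<(real a + 1) / 2 ^ (3 * M)})" for M
  have fin: "finite (bad M)" for M by (simp add: bad_def)
  have card: "real (card (bad M)) \<le> 2 ^ (3 * M) * (1 / (real M + 1)\<^sup>2)" for M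
  proof -
    define D where "D = (real M + 1)\<^sup>2 * (2 * (3 * real M * mean_bound n M + 1))"
    have D: "D > 0"
      unfolding D_def using mean_bound_nonneg[of n M]
      by (intro mult_pos_pos zero_less_power add_nonneg_pos mult_nonneg_nonneg) auto
    have "real (card (bad M)) * threshold n M = (\<Sum>a\<in>bad M. threshold n M)" by simp
    also have "\<dots> \<le> (\<Sum>a\<in>bad M. riesz_total n M a)"
      by (intro sum_mono) (auto simp: bad_def)
    also have "\<dots> \<le> (\<Sum>a<2 ^ (3 * M). riesz_total n M a)"
      by (intro sum_mono2 riesz_total_nonneg) (auto simp: bad_def)
    also have "\<dots> \<le> 2 ^ (3 * M) * D"
      unfolding D_def by (rule riesz_total_mean_le[OF assms])
    finally have "real (card (bad M)) * (real M + 1)\<^sup>2 * D \<le> 2 ^ (3 * M) * D"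
      by (simp add: threshold_def D_def mult.assoc)
    hence "real (card (bad M)) * (real M + 1)\<^sup>2 \<le> 2 ^ (3 * M)"
      using D by simp
    moreover have "(real M + 1)\<^sup>2 > 0" by (intro zero_less_power) simp
    ultimately show ?thesis by (simp add: pos_le_divide_eq)
  qed
  have em: "emeasure lborel (A M) \<le> ennreal (1 / (real M + 1)\<^sup>2)" for M
  proof -
    have "emeasure lborel (A M) \<le> (\<Sum>a\<in>bad M. emeasure lborel {real a / 2 ^ (3 * M)..<(real a + 1) / 2 ^ (3 * M)})"
      unfolding A_def by (rule emeasure_subadditive_finite[OF fin]) auto
    also have "\<dots> = (\<Sum>a\<in>bad M. ennreal (1 / 2 ^ (3 * M)))"
      by (intro sum.cong refl) (simp add: add_divide_distrib)
    also have "\<dots> = ennreal (real (card (bad M)) * (1 / 2 ^ (3 * M)))"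
      by (simp only: sum_constant ennreal_of_nat_eq_real_of_nat ennreal_mult[symmetric] of_nat_0_le_iff zero_le_divide_1_iff zero_le_power zero_le_numeral)
    also have "\<dots> \<le> ennreal (1 / (real M + 1)\<^sup>2)"
      using card[of M] by (intro ennreal_leI) (simp add: pos_divide_le_eq mult.commute)
    finally show ?thesis .
  qed
  have sets: "A M \<in> sets lborel" for M
    unfolding A_def by (intro sets.finite_UN fin) auto
  have "AE \<alpha> in lborel. eventually (\<lambda>M. \<alpha> \<in> space lborel - A M) sequentially"
  proof (rule borel_cantelli_AE1[OF sets])
    show "emeasure lborel (A M) < \<infinity>" for M
      using em[of M] by (rule le_less_trans) simp
    have "summable (\<lambda>M. inverse (real (Suc M) ^ 2))"
      using inverse_power_summable[where 'a = real, of 2] by (subst summable_Suc_iff) simp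
    thus "summable (\<lambda>M. measure lborel (A M))"
    proof (rule summable_comparison_test_ev[rotated], intro always_eventually allI)
      fix M
      have "measure lborel (A M) \<le> 1 / (real M + 1)\<^sup>2"
        unfolding measure_def using em[of M] by (intro enn2real_leI) auto
      thus "norm (measure lborel (A M)) \<le> inverse (real (Suc M) ^ 2)"
        by (simp add: divide_inverse add.commute)
    qed
  qed
  thus ?thesis
  proof eventually_elim
    case (elim \<alpha>)
    show ?case
    proof
      assume \<alpha>: "0 \<le> \<alpha> \<and> \<alpha> < 1"
      show "eventually (\<lambda>M. riesz_total n M (nat \<lfloor>\<alpha> * real (2 ^ (3 * M))\<rfloor>) \<le> threshold n M) sequentially"
        using elim
      proof eventually_elim
        case (elim M)
        define a where "a = nat \<lfloor>\<alpha> * real (2 ^ (3 * M))\<rfloor>"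
        have "real a = \<lfloor>\<alpha> * real (2 ^ (3 * M))\<rfloor>" using \<alpha> by (simp add: a_def)
        hence a: "real a \<le> \<alpha> * 2 ^ (3 * M)" "\<alpha> * 2 ^ (3 * M) < real a + 1" by simp_all
        have "\<alpha> * 2 ^ (3 * M) < 2 ^ (3 * M)" using \<alpha> by simp
        hence "real a < 2 ^ (3 * M)" using a(1) by linarith
        hence "a < 2 ^ (3 * M)" by simp
        moreover have "\<alpha> \<in> {real a / 2 ^ (3 * M)..<(real a + 1) / 2 ^ (3 * M)}"
          using a by (simp add: pos_divide_le_eq pos_less_divide_eq)
        hence "a \<notin> bad M" using elim by (auto simp: A_def)
        ultimately show ?case by (simp add: bad_def a_def)
      qed
    qed
  qed
qed

section \<open>From controlled weights to the asymptotic bound\<close>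

lemma star_discrepancy_halton_kronecker_le:
  assumes "n \<ge> 1" "N \<ge> 1" "N \<le> 2 ^ M" "0 \<le> \<alpha>" "\<alpha> < 1"
    and "riesz_total n M (nat \<lfloor>\<alpha> * real (2 ^ (3 * M))\<rfloor>) \<le> threshold n M"
  shows "real N * star_discrepancy (halton_kronecker n \<alpha>) N
    \<le> 3 * ((real M + 1)\<^sup>2 * (2 * threshold n M + 2 ^ n + 2)) + 3"
proof (rule star_discrepancy_le[OF _ assms(2)])
  fix x1 x2 :: real assume x: "0 < x1" "x1 \<le> 1" "0 < x2" "x2 \<le> 1"
  define a where "a = nat \<lfloor>\<alpha> * real (2 ^ (3 * M))\<rfloor>"
  show "\<bar>real (card {k. k < N \<and> halton_kronecker n \<alpha> k \<in> {0..<x1} \<times> {0..<x2}}) - real N * x1 * x2\<bar>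
    \<le> 3 * ((real M + 1)\<^sup>2 * (2 * threshold n M + 2 ^ n + 2)) + 3"
  proof (rule star_discrepancy_term_le[OF assms(2-5) refl a_def _ x])
    fix c v :: nat assume "c \<le> 2 ^ M" "v \<le> 2 ^ (3 * M)"
    thus "\<bar>(\<Sum>k<N. of_bool (output_prefix n k M < c \<and> k * a mod 2 ^ (3 * M) < v))
        - real N * (real c / 2 ^ M) * (real v / real (2 ^ (3 * M)))\<bar>
      \<le> (real M + 1)\<^sup>2 * (2 * threshold n M + 2 ^ n + 2)"
      using assms(6) unfolding a_def[symmetric]
      by (intro dyadic_box_le assms)
         (auto intro: order.trans[OF riesz_weight_le_total(1)] order.trans[OF riesz_weight_le_total(2)])
  qed
qed

text \<open>The exponent 8 consists of two powers each from the dyadic decompositions, the factor in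
  Markov's inequality, the number of pairs (m, L) and the product
  \<open>3 * real M * mean_bound n M\<close>.\<close>

lemma discrepancy_bound_le:
  fixes n M :: nat
  shows "3 * ((real M + 1)\<^sup>2 * (2 * threshold n M + 2 ^ n + 2)) + 3
    \<le> 60 * 4 ^ n * (real M + 2) ^ 8 * (2 * (real n + 1)) ^ (M div n)"
proof -
  define y where "y = real M + 2"
  define X where "X = (2 * (real n + 1)) ^ (M div n)"
  define F :: real where "F = 4 ^ n"
  have y: "y \<ge> 1" by (simp add: y_def)
  have X: "X \<ge> 1" unfolding X_def by (intro one_le_power) simp
  have F: "F \<ge> 1" unfolding F_def by (intro one_le_power) simp
  have sq: "(real M + 1)\<^sup>2 \<le> y\<^sup>2" by (intro power_mono) (auto simp: y_def)
  have mb: "mean_bound n M = F * y * X" by (simp add: mean_bound_def F_def y_def X_def)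
  have FX: "F * X \<ge> 1" using mult_mono[of 1 F 1 X] F X by simp
  have pw: "1 \<le> y ^ k" for k using y by (rule one_le_power)
  have "3 * real M * mean_bound n M + 1 \<le> 3 * y * (F * y * X) + 1 * (1 * 1)"
    unfolding mb using F X y by (intro add_mono mult_mono) (auto simp: y_def)
  also have "\<dots> \<le> 3 * y * (F * y * X) + 1 * (y\<^sup>2 * (F * X))"
    using pw[of 2] FX by (intro add_left_mono mult_mono) auto
  also have "\<dots> = 4 * (F * y\<^sup>2 * X)" by (simp add: power2_eq_square)
  finally have t1: "3 * real M * mean_bound n M + 1 \<le> 4 * (F * y\<^sup>2 * X)" .
  have "threshold n M \<le> y\<^sup>2 * (y\<^sup>2 * (2 * (4 * (F * y\<^sup>2 * X))))"
    unfolding threshold_def using t1 sq mean_bound_nonneg[of n M] by (intro mult_mono) auto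
  also have "\<dots> = 8 * (F * X) * y ^ 6" by (simp add: eval_nat_numeral)
  finally have t2: "threshold n M \<le> 8 * (F * X) * y ^ 6" .
  have n2: "2 ^ n \<le> F * X * y ^ 6"
  proof -
    have "(2::real) ^ n \<le> F" unfolding F_def by (intro power_mono) auto
    also have "\<dots> = F * 1 * 1" by simp
    also have "\<dots> \<le> F * X * y ^ 6" using F X pw[of 6] by (intro mult_mono) auto
    finally show ?thesis .
  qed
  have one6: "1 \<le> F * X * y ^ 6" using mult_mono[of 1 "F * X" 1 "y ^ 6"] FX pw[of 6] by simp
  \<comment> \<open>19 = 2 * 8 + 1 + 2, and later 60 = 3 * 19 + 3.\<close>
  have "2 * threshold n M + 2 ^ n + 2 \<le> 19 * (F * X * y ^ 6)" using t2 n2 one6 by linarith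
  hence "(real M + 1)\<^sup>2 * (2 * threshold n M + 2 ^ n + 2) \<le> y\<^sup>2 * (19 * (F * X * y ^ 6))"
    using sq one6 by (intro mult_mono) (auto simp: threshold_def mean_bound_nonneg)
  also have "\<dots> = 19 * (F * X * y ^ 8)" by (simp add: eval_nat_numeral)
  finally have "(real M + 1)\<^sup>2 * (2 * threshold n M + 2 ^ n + 2) \<le> 19 * (F * X * y ^ 8)" .
  moreover have "1 \<le> F * X * y ^ 8" using mult_mono[of 1 "F * X" 1 "y ^ 8"] FX pw[of 8] by simp
  ultimately have "3 * ((real M + 1)\<^sup>2 * (2 * threshold n M + 2 ^ n + 2)) + 3 \<le> 60 * (F * X * y ^ 8)"
    by linarith
  thus ?thesis by (simp add: F_def X_def y_def mult_ac)
qed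

text \<open>N lies between 2^(M-1) and 2^M for some M, and passing from 2^M back to 2N costs only
  the constant 2^(e + \<epsilon>). The exponent e satisfies (2^n)^e = 2(n + 1), so the main factor
  is at most 2^(M e).\<close>

lemma star_discrepancy_bigo:
  assumes "n \<ge> 1" "0 \<le> \<alpha>" "\<alpha> < 1" "\<epsilon> > 0"
    and ev: "eventually (\<lambda>M. riesz_total n M (nat \<lfloor>\<alpha> * real (2 ^ (3 * M))\<rfloor>) \<le> threshold n M) sequentially"
  shows "(\<lambda>N. real N * star_discrepancy (halton_kronecker n \<alpha>) N)
    \<in> O(\<lambda>N. real N powr (log (2 ^ n) (2 * (real n + 1)) + \<epsilon>))"
proof -
  define e where "e = log (2 ^ n) (2 * (real n + 1))"
  have n2: "(2::real) ^ n > 1" using assms(1) by (intro one_less_power) auto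
  have e0: "e \<ge> 0" unfolding e_def using n2 by (subst zero_le_log_cancel_iff) auto
  have b: "(2 * (real n + 1)) ^ (M div n) \<le> (2 ^ M) powr e" for M
  proof -
    have "(2 * (real n + 1)) ^ (M div n) = (2 * (real n + 1)) powr real (M div n)"
      by (subst powr_realpow) auto
    also have "\<dots> \<le> (2 * (real n + 1)) powr (real M / real n)"
      by (intro powr_mono of_nat_div_le_of_nat) auto
    also have "\<dots> = ((2 ^ n) powr e) powr (real M / real n)"
      unfolding e_def using n2 by (subst powr_log_cancel) auto
    also have "\<dots> = ((2 powr real n) powr e) powr (real M / real n)"
      by (simp add: powr_realpow)
    also have "\<dots> = (2 powr real M) powr e"
      using assms(1) by (simp add: powr_powr mult.commute)
    finally show ?thesis by (simp add: powr_realpow)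
  qed
  \<comment> \<open>A convergent sequence is bounded, so one constant works for all M.\<close>
  obtain C where C: "C > 0" "\<And>M. (real M + 2) ^ 8 \<le> C * (2 ^ M) powr \<epsilon>"
  proof -
    have "(\<lambda>M::nat. (real M + 2) ^ 8 / 2 powr (\<epsilon> * real M)) \<longlonglongrightarrow> 0"
      using assms(4) by real_asymp
    hence "Bseq (\<lambda>M::nat. (real M + 2) ^ 8 / 2 powr (\<epsilon> * real M))"
      by (intro convergent_imp_Bseq) (auto simp: convergent_def)
    then obtain C where C: "C > 0" "\<And>M. norm ((real M + 2) ^ 8 / 2 powr (\<epsilon> * real M)) \<le> C"
      by (auto elim: BseqE)
    have "(real M + 2) ^ 8 \<le> C * (2 ^ M) powr \<epsilon>" for M
    proof -
      have "(2 ^ M) powr \<epsilon> = 2 powr (\<epsilon> * real M)"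
        by (simp add: powr_powr mult.commute flip: powr_realpow)
      thus ?thesis using C(2)[of M] by (simp add: pos_divide_le_eq)
    qed
    with C(1) that show ?thesis by blast
  qed
  from ev obtain M0 where M0: "\<And>M. M \<ge> M0 \<Longrightarrow>
      riesz_total n M (nat \<lfloor>\<alpha> * real (2 ^ (3 * M))\<rfloor>) \<le> threshold n M"
    by (auto simp: eventually_sequentially)
  define K where "K = 60 * 4 ^ n * C * 2 powr (e + \<epsilon>)"
  have "norm (real N * star_discrepancy (halton_kronecker n \<alpha>) N) \<le> K * norm (real N powr (e + \<epsilon>))"
    if N: "N \<ge> 2 ^ M0" for N
  proof -
    have "(1::nat) \<le> 2 ^ M0" by simp
    hence N1: "N \<ge> 1" using N by linarith
    obtain M' where M': "2 ^ M' \<le> N" "N < 2 ^ (M' + 1)"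
      using ex_power_ivl1[of 2 N] N1 by auto
    define M where "M = M' + 1"
    have "(2::nat) ^ M0 < 2 ^ M" using N M'(2) by (simp add: M_def)
    hence "M0 < M" by simp
    have N2: "(2::real) ^ M \<le> 2 * real N"
    proof -
      have "(2::real) ^ M' \<le> real N" using M'(1) by simp
      thus ?thesis by (simp add: M_def)
    qed
    have "0 \<le> real N * star_discrepancy (halton_kronecker n \<alpha>) N"
      using star_discrepancy_halton_kronecker_ge[OF N1, of n \<alpha>] by simp
    hence "norm (real N * star_discrepancy (halton_kronecker n \<alpha>) N)
        = real N * star_discrepancy (halton_kronecker n \<alpha>) N" by simp
    also have "\<dots> \<le> 3 * ((real M + 1)\<^sup>2 * (2 * threshold n M + 2 ^ n + 2)) + 3"
      using assms N1 M' \<open>M0 < M\<close> by (intro star_discrepancy_halton_kronecker_le M0) (auto simp: M_def)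
    also have "\<dots> \<le> 60 * 4 ^ n * (real M + 2) ^ 8 * (2 * (real n + 1)) ^ (M div n)"
      by (rule discrepancy_bound_le)
    also have "\<dots> \<le> 60 * 4 ^ n * (C * (2 ^ M) powr \<epsilon>) * (2 ^ M) powr e"
      using C b by (intro mult_mono) auto
    also have "\<dots> = 60 * 4 ^ n * C * (2 ^ M) powr (e + \<epsilon>)"
      by (simp add: powr_add)
    also have "\<dots> \<le> 60 * 4 ^ n * C * (2 * real N) powr (e + \<epsilon>)"
      using C e0 assms(4) N2 by (intro mult_left_mono powr_mono2) auto
    also have "\<dots> = K * norm (real N powr (e + \<epsilon>))"
      by (simp add: K_def powr_mult)
    finally show ?thesis .
  qed
  thus ?thesis
    unfolding e_def[symmetric]
    by (intro bigoI[where c = K] eventually_sequentiallyI[of "2 ^ M0"]) auto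
qed

theorem theorem1p4:
  "\<exists>lam1 lam2 :: nat \<Rightarrow> real.
     (\<forall>n\<ge>1. 0 < lam1 n \<and> 0 < lam2 n \<and>
        0 \<le> 1 + log (2 ^ n) (lam1 n) \<and>
        1 + log (2 ^ n) (lam1 n) \<le> 1 + log (2 ^ n) (lam2 n)) \<and>
     (\<lambda>n. 1 + log (2 ^ n) (lam2 n)) \<longlonglongrightarrow> 0 \<and>
     (\<forall>n\<ge>1. AE \<alpha> in lebesgue. \<alpha> \<in> {0<..<1} \<longrightarrow>
        (\<forall>\<epsilon>>0.
           (\<lambda>N. real N * star_discrepancy (halton_kronecker n \<alpha>) N)
             \<in> O(\<lambda>N. real N powr (1 + log (2 ^ n) (lam2 n) + \<epsilon>)) \<and>
           (\<exists>c>0. \<exists>\<^sub>F N in sequentially.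
              \<bar>real N * star_discrepancy (halton_kronecker n \<alpha>) N\<bar>
                \<ge> c * \<bar>real N powr (1 + log (2 ^ n) (lam1 n) - \<epsilon>)\<bar>)))"
proof -
  define lam1 lam2 :: "nat \<Rightarrow> real"
    where "lam1 n = 1 / 2 ^ n" and "lam2 n = 2 * (real n + 1) / 2 ^ n" for n
  have e1: "1 + log (2 ^ n) (lam1 n) = 0"
    and e2: "1 + log (2 ^ n) (lam2 n) = log (2 ^ n) (2 * (real n + 1))"
    and e2_nonneg: "0 \<le> log (2 ^ n) (2 * (real n + 1))" if "n \<ge> 1" for n
  proof -
    have n2: "(2::real) ^ n > 1" using that by (intro one_less_power) auto
    show "1 + log (2 ^ n) (lam1 n) = 0"
      using n2 by (simp add: lam1_def log_divide)
    show "1 + log (2 ^ n) (lam2 n) = log (2 ^ n) (2 * (real n + 1))"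
      using n2 unfolding lam2_def by (subst log_divide) auto
    show "0 \<le> log (2 ^ n) (2 * (real n + 1))"
      using n2 by (subst zero_le_log_cancel_iff) auto
  qed
  have "(\<lambda>n. ln (2 * (real n + 1)) / (real n * ln 2)) \<longlonglongrightarrow> 0"
    by real_asymp
  hence lim: "(\<lambda>n. 1 + log (2 ^ n) (lam2 n)) \<longlonglongrightarrow> 0"
  proof (rule Lim_transform_eventually)
    show "\<forall>\<^sub>F n in sequentially. ln (2 * (real n + 1)) / (real n * ln 2) = 1 + log (2 ^ n) (lam2 n)"
      using eventually_ge_at_top[of 1]
    proof eventually_elim
      case (elim n)
      show ?case unfolding e2[OF elim] by (simp add: log_def ln_realpow)
    qed
  qed
  have ae: "AE \<alpha> in lebesgue. \<alpha> \<in> {0<..<1} \<longrightarrow>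
        (\<forall>\<epsilon>>0.
           (\<lambda>N. real N * star_discrepancy (halton_kronecker n \<alpha>) N)
             \<in> O(\<lambda>N. real N powr (1 + log (2 ^ n) (lam2 n) + \<epsilon>)) \<and>
           (\<exists>c>0. \<exists>\<^sub>F N in sequentially.
              \<bar>real N * star_discrepancy (halton_kronecker n \<alpha>) N\<bar>
                \<ge> c * \<bar>real N powr (1 + log (2 ^ n) (lam1 n) - \<epsilon>)\<bar>))" if n: "n \<ge> 1" for n
    \<comment> \<open>This almost-everywhere statement does not mention \<epsilon>, so one null set
      serves all \<epsilon>.\<close>
    using AE_completion[OF AE_eventually_riesz_total_le[OF n]]
  proof eventually_elim
    case (elim \<alpha>)
    show ?case
    proof (intro impI allI conjI)
      fix \<epsilon> :: real assume \<alpha>: "\<alpha> \<in> {0<..<1}" and \<epsilon>: "\<epsilon> > 0"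
      show "(\<lambda>N. real N * star_discrepancy (halton_kronecker n \<alpha>) N)
             \<in> O(\<lambda>N. real N powr (1 + log (2 ^ n) (lam2 n) + \<epsilon>))"
        unfolding e2[OF n] using elim \<alpha> \<epsilon> n by (intro star_discrepancy_bigo) auto
      have "1 / 2 * \<bar>real N powr (1 + log (2 ^ n) (lam1 n) - \<epsilon>)\<bar>
          \<le> \<bar>real N * star_discrepancy (halton_kronecker n \<alpha>) N\<bar>" if N: "N \<ge> 1" for N
      proof -
        have "real N powr (- \<epsilon>) \<le> real N powr 0" using N \<epsilon> by (intro powr_mono) auto
        thus ?thesis
          using star_discrepancy_halton_kronecker_ge[OF N, of n \<alpha>] N by (simp add: e1[OF n])
      qed
      hence "\<forall>\<^sub>F N in sequentially. 1 / 2 * \<bar>real N powr (1 + log (2 ^ n) (lam1 n) - \<epsilon>)\<bar>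
          \<le> \<bar>real N * star_discrepancy (halton_kronecker n \<alpha>) N\<bar>"
        by (intro eventually_sequentiallyI[of 1]) auto
      hence "\<exists>\<^sub>F N in sequentially. 1 / 2 * \<bar>real N powr (1 + log (2 ^ n) (lam1 n) - \<epsilon>)\<bar>
          \<le> \<bar>real N * star_discrepancy (halton_kronecker n \<alpha>) N\<bar>"
        by (intro eventually_frequently) auto
      thus "\<exists>c>0. \<exists>\<^sub>F N in sequentially.
              \<bar>real N * star_discrepancy (halton_kronecker n \<alpha>) N\<bar>
                \<ge> c * \<bar>real N powr (1 + log (2 ^ n) (lam1 n) - \<epsilon>)\<bar>"
        by (intro exI[of _ "1 / 2"]) auto
    qed
  qed
  show ?thesis
  proof (rule exI[of _ lam1], rule exI[of _ lam2], intro conjI allI impI lim ae)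
    fix n :: nat assume n: "n \<ge> 1"
    show "0 < lam1 n" "0 < lam2 n" by (simp_all add: lam1_def lam2_def)
    show "0 \<le> 1 + log (2 ^ n) (lam1 n)" "1 + log (2 ^ n) (lam1 n) \<le> 1 + log (2 ^ n) (lam2 n)"
      using e1[OF n] e2[OF n] e2_nonneg[OF n] by simp_all
  qed
qed

end
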